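(* Let $d$ be an odd positive integer. If the simplicial complex $\mathbf S_{2d+1,d}$ is positively decorable, then $$[X^{2d+1}Y^{(d+1)/2}]\,\frac{1+X+X^3Y}{1-X^2-X^2Y-X^4Y}\le\Xi_{d,d}.$$
   Context: $[X^iY^j]S(X,Y)$ denotes the coefficient of $X^iY^j$ in the formal power series expansion of the rational function $S$. $\Xi_{d,k}$ denotes the maximum number of non-degenerate (invertible Jacobian) solutions in the positive orthant over all polynomial systems of $d$ equations in $d$ variables with real coefficients involving at most $d+k+1$ monomials in total. Let $a_1<\cdots<a_n$ be real numbers and let the cyclic polytope $C(n,d)$ be the convex hull in $\mathbb R^d$ of the points $(a_i,a_i^2,\ldots,a_i^d)$, labelled by $i=1,\dots,n$. For $d$ odd, $C(n,d)$ has a regular triangulation $\hat{\mathbf 0}_{n,d}$ (obtained by projecting the lower part of $C(n,d+1)$ with respect to the last coordinate) whose $d$-simplices are those with vertex sets $\{i_1,i_1+1,\ldots,i_{m},i_{m}+1\}$, where $m=\frac{d+1}2$, $1\le i_1$, $i_{m}+1\le n$ and $i_{j+1}\ge i_j+2$ for $1\le j<m$. $\mathbf S_{n,d}$ is the subcomplex whose maximal simplices are those $d$-simplices $i_1<\cdots<i_{m}$ such that for all $1\le j<m$, either $i_j$ is odd or $i_{j+1}-i_j>2$. A real $d\times(d+1)$ matrix $M$ is oriented if the values $(-1)^i\operatorname{minor}(M,i)$ ($\operatorname{minor}(M,i)$ is the determinant after removing the $i$-th column) are all nonzero and of the same sign. A pure $d$-dimensional complex on vertices $1,\dots,n$ is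 positively decorable if there is a real $d\times n$ matrix $C$ such that for every $d$-simplex the submatrix of $C$ formed by the $d+1$ columns indexed by its vertices is oriented. *)

theory Defs
  imports
    "HOL-Analysis.Derivative"
    "HOL-Library.FuncSet"
    "HOL-Library.Poly_Mapping"
    "HOL-Library.Extended_Real"
    "HOL-Computational_Algebra.Formal_Power_Series"
    "Jordan_Normal_Form.Determinant"
    "Jordan_Normal_Form.DL_Submatrix"
begin

section \<open>Fewnomial systems\<close>

text \<open>
  A real polynomial is a finitely supported map from exponent vectors to coefficients,
  and an exponent vector is a finitely supported map from variable indices to exponents.
  Variables and equations of a system in \<open>d\<close> variables are indexed by \<open>{..<d}\<close>.
\<close>

type_synonym rpoly = "(nat \<Rightarrow>\<^sub>0 nat) \<Rightarrow>\<^sub>0 real"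

definition poly_val :: "rpoly \<Rightarrow> (nat \<Rightarrow> real) \<Rightarrow> real" where
  "poly_val p x =
     (\<Sum>m\<in>Poly_Mapping.keys p. Poly_Mapping.lookup p m *
        (\<Prod>i\<in>Poly_Mapping.keys m. x i ^ Poly_Mapping.lookup m i))"

text \<open>Monomials are counted over the whole system, a monomial shared by several equations
  counting once.\<close>

definition fewnomial_systems :: "nat \<Rightarrow> nat \<Rightarrow> (nat \<Rightarrow> rpoly) set" where
  "fewnomial_systems d k =
     {p. (\<forall>i<d. \<forall>m\<in>Poly_Mapping.keys (p i). Poly_Mapping.keys m \<subseteq> {..<d}) \<and>
         card (\<Union>i<d. Poly_Mapping.keys (p i)) \<le> d + k + 1}"

definition jacobian :: "nat \<Rightarrow> (nat \<Rightarrow> rpoly) \<Rightarrow> (nat \<Rightarrow> real) \<Rightarrow> real mat" where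
  "jacobian d p x = mat d d (\<lambda>(i, j). deriv (\<lambda>t. poly_val (p i) (x(j := t))) (x j))"

text \<open>Points are extensional functions on \<open>{..<d}\<close>, so that distinct functions are distinct
  points.\<close>

definition nondegenerate_positive_solutions :: "nat \<Rightarrow> (nat \<Rightarrow> rpoly) \<Rightarrow> (nat \<Rightarrow> real) set" where
  "nondegenerate_positive_solutions d p =
     {x \<in> {..<d} \<rightarrow>\<^sub>E {0<..}.
        (\<forall>i<d. poly_val (p i) x = 0) \<and> invertible_mat (jacobian d p x)}"

definition ecard :: "'a set \<Rightarrow> enat" where
  "ecard A = (if finite A then enat (card A) else \<infinity>)"

text \<open>By Khovanskii's fewnomial bound these cardinalities are finite and bounded in terms of
  \<open>d\<close> and \<open>k\<close>, so the supremum is a natural number and is attained. Taking it in \<open>enat\<close> gives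
  the maximum without having to build that bound into the definition.\<close>

definition Xi :: "nat \<Rightarrow> nat \<Rightarrow> enat" where
  "Xi d k = (SUP p\<in>fewnomial_systems d k. ecard (nondegenerate_positive_solutions d p))"


section \<open>The complexes\<close>

text \<open>
  A \<open>d\<close>-simplex \<open>{i\<^sub>1, i\<^sub>1 + 1, \<dots>, i\<^sub>m, i\<^sub>m + 1}\<close> with \<open>m = (d + 1) / 2\<close> is encoded by the list
  \<open>[i\<^sub>1, \<dots>, i\<^sub>m]\<close>. The list positions start at 0, the vertex labels at 1.
\<close>

definition paired_indices :: "nat \<Rightarrow> nat \<Rightarrow> nat list \<Rightarrow> bool" where
  "paired_indices n d is \<longleftrightarrow>
     length is = (d + 1) div 2 \<and>
     (\<forall>i\<in>set is. 1 \<le> i \<and> i + 1 \<le> n) \<and>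
     (\<forall>j. Suc j < length is \<longrightarrow> is ! j + 2 \<le> is ! Suc j)"

definition pair_simplex :: "nat list \<Rightarrow> nat set" where
  "pair_simplex is = set is \<union> Suc ` set is"

text \<open>For odd \<open>d\<close>, the triangulation of the cyclic polytope \<open>C(n,d)\<close> given by the lower facets
  of \<open>C(n,d+1)\<close>, as an abstract complex (closed under faces).\<close>

definition cyclic_lower_triangulation :: "nat \<Rightarrow> nat \<Rightarrow> nat set set" where
  "cyclic_lower_triangulation n d = {\<tau>. \<exists>is. paired_indices n d is \<and> \<tau> \<subseteq> pair_simplex is}"

definition S_complex :: "nat \<Rightarrow> nat \<Rightarrow> nat set set" where
  "S_complex n d =
     {\<tau>. \<exists>is. paired_indices n d is \<and>
        (\<forall>j. Suc j < length is \<longrightarrow> odd (is ! j) \<or> is ! Suc j - is ! j > 2) \<and>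
        \<tau> \<subseteq> pair_simplex is}"

lemma S_complex_subcomplex: "S_complex n d \<subseteq> cyclic_lower_triangulation n d"
  by (auto simp: S_complex_def cyclic_lower_triangulation_def)


section \<open>Positive decorations\<close>

definition minor :: "real mat \<Rightarrow> nat \<Rightarrow> real" where
  "minor M c = det (submatrix M UNIV (- {c}))"

text \<open>Counting columns from 0 rather than from 1 flips all the signs at once.\<close>

definition oriented :: "nat \<Rightarrow> real mat \<Rightarrow> bool" where
  "oriented d M \<longleftrightarrow> M \<in> carrier_mat d (d + 1) \<and>
     ((\<forall>c\<le>d. (-1) ^ c * minor M c > 0) \<or> (\<forall>c\<le>d. (-1) ^ c * minor M c < 0))"

text \<open>Vertex \<open>v \<in> {1..n}\<close> labels the column with index \<open>v - 1\<close>; \<^const>\<open>submatrix\<close> keeps the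
  columns in increasing order.\<close>

definition positively_decorable :: "nat \<Rightarrow> nat \<Rightarrow> nat set set \<Rightarrow> bool" where
  "positively_decorable n d K \<longleftrightarrow>
     (\<exists>C \<in> carrier_mat d n. \<forall>\<sigma>\<in>K. card \<sigma> = d + 1 \<longrightarrow>
        oriented d (submatrix C UNIV ((\<lambda>v. v - 1) ` \<sigma>)))"


section \<open>The generating function\<close>

text \<open>Bivariate power series are power series in \<open>X\<close> whose coefficients are power series in \<open>Y\<close>,
  so that the coefficient of \<open>X\<^sup>i Y\<^sup>j\<close> is \<open>fps_nth (fps_nth S i) j\<close>. The ring of series in \<open>Y\<close>
  is not a field; the two lemmas below check that the quotient is the intended one.\<close>

abbreviation bX :: "real fps fps" where "bX \<equiv> fps_X"
abbreviation bY :: "real fps fps" where "bY \<equiv> fps_const fps_X"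

definition coeff_XY :: "nat \<Rightarrow> nat \<Rightarrow> real fps fps \<Rightarrow> real" where
  "coeff_XY i j S = fps_nth (fps_nth S i) j"

lemma coeff_XY_monomial: "coeff_XY i j (bX ^ a * bY ^ b) = (if i = a \<and> j = b then 1 else 0)"
  by (simp add: coeff_XY_def fps_X_power_iff fps_const_power fps_mult_right_const_nth)

lemma rational_function_unique_expansion:
  fixes N D S :: "real fps fps"
  assumes "fps_nth D 0 = 1"
  shows "S = N / D \<longleftrightarrow> S * D = N"
proof -
  have "inverse D = fps_right_inverse D 1"
    unfolding fps_inverse_def[of D] using assms by simp
  then have inv: "inverse D * D = 1"
    using assms fps_right_inverse[of D 1] by (simp add: mult.commute)
  have "subdegree D = 0"
    using assms by (simp add: subdegree_eq_0_iff)
  then have "N / D = N * inverse D"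
    by (rule fps_divide_unit')
  moreover have "S * D * inverse D = S" "N * inverse D * D = N"
    using inv by (simp_all add: mult.assoc mult.commute[of D])
  ultimately show ?thesis
    by auto
qed

end

theory Submission
  imports Defs
begin

text \<open>
  This is Viro's patchworking method for the moment curve. Place the monomials at the vertices
  \<open>(j, j\<^sup>2, \<dots>, j\<^sup>d)\<close>, \<open>1 \<le> j \<le> n\<close>, of the cyclic polytope, where \<open>n = 2 * d + 1\<close>, and let \<open>C\<close> be a
  matrix that positively decorates the complex. The system of \<open>d\<close> equations with the coefficients
  \<open>C i j * t ^ (j ^ (d + 1))\<close> has at most \<open>n = d + d + 1\<close> monomials. The heights \<open>j ^ (d + 1)\<close> induce the lower
  triangulation: for a simplex \<open>\<sigma>\<close> of the complex the polynomial \<open>\<Prod>v\<in>\<sigma>. x - v\<close> vanishes on \<open>\<sigma>\<close> and is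
  at least 1 at the other integers, and it differs from \<open>x ^ (d + 1)\<close> by a polynomial of degree at
  most \<open>d\<close>, which is an affine function on the moment curve. A substitution
  \<open>x\<^sub>k \<mapsto> x\<^sub>k * t powr (- c\<^sub>k)\<close> with the coefficients of this function therefore turns the system, up to
  a common factor, into the system supported on \<open>\<sigma>\<close> plus terms that vanish as \<open>t\<close> tends to 0. The
  system supported on \<open>\<sigma>\<close> is linear in its \<open>d + 1\<close> monomials, and since \<open>\<sigma>\<close> is oriented it has exactly one positive
  solution, a nondegenerate one; this solution persists for small \<open>t\<close>
  (\<open>oriented_simplex_persists\<close>). Solutions from different simplices lie at different scales, so they
  are distinct, and \<open>Xi d d\<close> is at least the number of maximal simplices
  (\<open>card_admissible_le_Xi\<close>). That number is bounded below by the coefficient of the generating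
  function, because the recurrence given by its denominator is realized by prepending an entry to
  a list (\<open>coeff_XY_le_card_admissible\<close>).

  The persistence is proved without the implicit function theorem, in logarithmic coordinates.
  A positive point is a polynomial of degree at most \<open>d\<close> without constant term, whose value at \<open>j\<close> is the logarithm of the
  \<open>j\<close>-th monomial, and Lagrange interpolation on \<open>\<sigma>\<close> expresses all monomials by those of \<open>\<sigma>\<close>. In these
  the system is a fixed-point equation \<open>z = z0 + small monomials in z\<close>, to which the contraction
  principle on a box applies (\<open>perturbed_monomial_fixed_point\<close>).
\<close>


section \<open>Counting the maximal simplices\<close>

text \<open>The lists encoding the maximal simplices. The two conditions on consecutive entries are merged
  into one lower bound for the next entry in terms of the current one, so that prepending an entry
  to a list can be checked locally. The number \<open>n\<close> of vertices and the length \<open>m\<close> vary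
  independently, because the recurrence below does not stay in the range \<open>n = 2 * d + 1\<close>,
  \<open>m = (d + 1) div 2\<close>.\<close>
definition admissible :: "nat \<Rightarrow> nat \<Rightarrow> nat list \<Rightarrow> bool" where
  "admissible n m is \<longleftrightarrow> length is = m \<and> (\<forall>i\<in>set is. 1 \<le> i \<and> i < n) \<and>
     successively (\<lambda>i j. i + (if odd i then 2 else 3) \<le> j) is"

lemma admissible_iff_paired_indices:
  assumes "odd d"
  shows "admissible n ((d + 1) div 2) is \<longleftrightarrow> paired_indices n d is \<and>
    (\<forall>j. Suc j < length is \<longrightarrow> odd (is ! j) \<or> is ! Suc j - is ! j > 2)"
proof -
  have *: "i + (if odd i then 2 else 3) \<le> j \<longleftrightarrow> i + 2 \<le> j \<and> (odd i \<or> j - i > 2)" for i j :: nat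
    by auto
  show ?thesis
    unfolding admissible_def paired_indices_def successively_conv_nth * by auto
qed

lemma finite_admissible: "finite {is. admissible n m is}"
  by (rule finite_subset[OF _ finite_lists_length_eq[of "{..n}" m]])
    (auto simp: admissible_def)

lemma admissible_Nil: "admissible n 0 []"
  by (simp add: admissible_def)

text \<open>Only even shifts are compatible with the condition, which depends on the parity of the entries;
  hence the recurrence reads the vertices in blocks of two.\<close>
lemma admissible_shift:
  "even c \<Longrightarrow> admissible n m is \<Longrightarrow> admissible (n + c) m (map ((+) c) is)"
  by (auto simp: admissible_def successively_map elim!: successively_mono split: if_splits)

lemma admissible_Cons1:
  assumes "admissible n m is"
  shows "admissible (n + 2) (Suc m) (1 # map ((+) 2) is)"
proof (cases "is")
  case (Cons i js)
  then show ?thesis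
    using admissible_shift[of 2, OF _ assms] assms by (auto simp: admissible_def)
qed (use assms in \<open>auto simp: admissible_def\<close>)

lemma admissible_Cons2:
  assumes "admissible n m is"
  shows "admissible (n + 4) (Suc m) (2 # map ((+) 4) is)"
proof (cases "is")
  case (Cons i js)
  then show ?thesis
    using admissible_shift[of 4, OF _ assms] assms by (auto simp: admissible_def)
qed (use assms in \<open>auto simp: admissible_def\<close>)

text \<open>A list starts at 3 or later, at 1, or at 2. In the first two cases the vertices 1 and 2 are used
  up, and in the last case the next entry is at least 5, so that four vertices are used up. These
  are the summands \<open>X\<^sup>2\<close>, \<open>X\<^sup>2 Y\<close> and \<open>X\<^sup>4 Y\<close> of the denominator of the generating function.
  The cases are disjoint and prepending is injective.\<close>
lemma card_admissible_recurrence: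
  "card {is. admissible n (Suc m) is} + card {is. admissible n m is}
     \<le> card {is. admissible (n + 2) (Suc m) is}" (is ?two)
  "card {is. admissible (n + 2) (Suc m) is} + card {is. admissible (n + 2) m is} +
     card {is. admissible n m is} \<le> card {is. admissible (n + 4) (Suc m) is}" (is ?four)
proof -
  let ?V = "\<lambda>n m. {is. admissible n m is}"
  let ?A = "\<lambda>n m. map ((+) 2) ` ?V n m" and ?B = "\<lambda>n m. (\<lambda>is. 1 # map ((+) 2) is) ` ?V n m"
    and ?C = "\<lambda>n m. (\<lambda>is. 2 # map ((+) 4) is) ` ?V n m"
  have inj: "inj_on f (?V n m)" if "f = map ((+) 2) \<or> f = (\<lambda>is. 1 # map ((+) 2) is) \<or>
      f = (\<lambda>is. 2 # map ((+) 4) is)" for f n m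
    using that by (auto simp: inj_on_def)
  have card: "card (?A n m) = card (?V n m)" "card (?B n m) = card (?V n m)"
    "card (?C n m) = card (?V n m)" for n m
    by (auto intro!: card_image inj)
  have fin: "finite (?A n m)" "finite (?B n m)" "finite (?C n m)" for n m
    by (simp_all add: finite_admissible)
  have AB: "?A n (Suc m) \<inter> ?B n m = {}" for n m
    by (auto simp: map_eq_Cons_conv admissible_def)
  have AC: "?A n (Suc m) \<inter> ?C n' m = {}" for n n' m
    by (auto simp: map_eq_Cons_conv admissible_def)
  have BC: "?B n m \<inter> ?C n' m = {}" for n n' m
    by auto
  have sub: "?A n m \<subseteq> ?V (n + 2) m" "?B n m \<subseteq> ?V (n + 2) (Suc m)" "?C n m \<subseteq> ?V (n + 4) (Suc m)" for n m
    using admissible_shift[of 2] admissible_Cons1 admissible_Cons2 by auto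
  have "card (?A n (Suc m) \<union> ?B n m) \<le> card (?V (n + 2) (Suc m))"
    by (rule card_mono[OF finite_admissible]) (use sub in auto)
  then show ?two
    using card_Un_disjoint[OF fin(1,2) AB] card by simp
  have "?A (n + 2) (Suc m) \<union> ?B (n + 2) m \<union> ?C n m \<subseteq> ?V (n + 4) (Suc m)"
    using sub(1)[of "n + 2" "Suc m"] sub(2)[of "n + 2" m] sub(3)[of n m]
    unfolding add.assoc numeral_Bit0[of "num.One", symmetric] by (auto simp: add.commute)
  then have "card (?A (n + 2) (Suc m) \<union> ?B (n + 2) m \<union> ?C n m) \<le> card (?V (n + 4) (Suc m))"
    by (rule card_mono[OF finite_admissible])
  moreover have "card (?A (n + 2) (Suc m) \<union> ?B (n + 2) m \<union> ?C n m) =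
      card (?A (n + 2) (Suc m)) + card (?B (n + 2) m) + card (?C n m)"
    using AB AC BC fin by (simp add: card_Un_disjoint Int_Un_distrib2)
  ultimately show ?four
    using card by simp
qed

text \<open>Clearing the denominator gives the coefficients the recurrence of the counts. The numerator
  supplies what the recurrence misses when fewer than four vertices remain: the empty list on no
  vertex, the empty list on one vertex, and the list \<open>[2]\<close> on three vertices.\<close>
lemma coeff_XY_le_card_admissible:
  defines "S \<equiv> (1 + bX + bX ^ 3 * bY) / (1 - bX ^ 2 - bX ^ 2 * bY - bX ^ 4 * bY)"
  shows "coeff_XY n m S \<le> card {is. admissible n m is}"
proof (induction n arbitrary: m rule: less_induct)
  case (less n)
  let ?T = "\<lambda>n m. coeff_XY n m S" and ?V = "\<lambda>n m. {is. admissible n m is}"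
  have "S * (1 - bX ^ 2 - bX ^ 2 * bY - bX ^ 4 * bY) = 1 + bX + bX ^ 3 * bY"
    by (subst rational_function_unique_expansion[symmetric]) (simp_all add: S_def)
  then have eq: "S = 1 + bX + bX ^ 3 * bY + S * bX ^ 2 + S * bX ^ 2 * bY + S * bX ^ 4 * bY"
    by (simp add: algebra_simps)
  have rec: "?T n m = (if n = 0 \<and> m = 0 then 1 else 0) + (if n = 1 \<and> m = 0 then 1 else 0)
      + (if n = 3 \<and> m = 1 then 1 else 0)
      + (if n < 2 then 0 else ?T (n - 2) m)
      + (if n < 2 \<or> m = 0 then 0 else ?T (n - 2) (m - 1))
      + (if n < 4 \<or> m = 0 then 0 else ?T (n - 4) (m - 1))" for n m
    by (subst eq) (auto simp: coeff_XY_def fps_X_power_mult_right_nth fps_X_power_nth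
        fps_mult_right_const_nth fps_one_nth)
  show ?case
  proof (cases m)
    case 0
    have "1 \<le> card (?V n 0)"
      using admissible_Nil[of n] finite_admissible[of n 0] by (auto simp: Suc_le_eq card_gt_0_iff)
    moreover have "?V k 0 = {[]}" for k
      by (auto simp: admissible_def)
    ultimately show ?thesis
      using less[of "n - 2" 0] 0 by (subst rec) auto
  next
    case (Suc k)
    consider "n < 2" | "n = 2" | "n = 3" | l where "n = l + 4"
      by (metis add.commute less_2_cases_iff not_less numeral_2_eq_2 numeral_3_eq_3 le_Suc_ex less_Suc_eq numeral_Bit0 add_2_eq_Suc)
    then show ?thesis
    proof cases
      case 1
      then show ?thesis using Suc by (subst rec) auto
    next
      case 2
      then show ?thesis
        using Suc less[of 0 m] less[of 0 k] card_admissible_recurrence(1)[of 0 k]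
        by (subst rec) (auto simp: numeral_2_eq_2)
    next
      case 3
      show ?thesis
      proof (cases k)
        case 0
        have "{[1], [2]} \<subseteq> ?V 3 1"
          by (auto simp: admissible_def)
        then have "card {[1], [2 :: nat]} \<le> card (?V 3 1)"
          by (rule card_mono[OF finite_admissible])
        moreover have "?T 3 1 = 2"
          by (subst rec) (simp add: rec[of "Suc 0"])
        ultimately show ?thesis
          using 0 3 Suc by simp
      next
        case (Suc k')
        then show ?thesis
          using \<open>m = Suc k\<close> 3 less[of 1 m] less[of 1 k] card_admissible_recurrence(1)[of 1 k]
          by (subst rec) (auto simp: eval_nat_numeral)
      qed
    next
      case 4
      then show ?thesis
        using Suc less[of "l + 2" m] less[of "l + 2" k] less[of l k] card_admissible_recurrence(2)[of l k]
        by (subst rec) auto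
    qed
  qed
qed

section \<open>Small monomial perturbations\<close>

text \<open>The contraction principle for the maximum norm on a box, for functions on an arbitrary finite
  index set. The dimension is a variable of the theorem and not a type, so the iteration is
  carried out coordinatewise; the consecutive differences are dominated by a geometric series.\<close>
lemma box_contraction_fixed_point:
  fixes a b :: "'i \<Rightarrow> real" and G :: "('i \<Rightarrow> real) \<Rightarrow> 'i \<Rightarrow> real"
  assumes "finite S" and ab: "\<And>i. i \<in> S \<Longrightarrow> a i \<le> b i"
    and self: "\<And>z i. (\<And>i. i \<in> S \<Longrightarrow> z i \<in> {a i..b i}) \<Longrightarrow> i \<in> S \<Longrightarrow> G z i \<in> {a i..b i}"
    and contr: "\<And>z w e i. (\<And>i. i \<in> S \<Longrightarrow> z i \<in> {a i..b i}) \<Longrightarrow> (\<And>i. i \<in> S \<Longrightarrow> w i \<in> {a i..b i}) \<Longrightarrow>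
      (\<And>i. i \<in> S \<Longrightarrow> \<bar>z i - w i\<bar> \<le> e) \<Longrightarrow> i \<in> S \<Longrightarrow> \<bar>G z i - G w i\<bar> \<le> e / 2"
  obtains z where "\<And>i. i \<in> S \<Longrightarrow> z i \<in> {a i..b i}" "\<And>i. i \<in> S \<Longrightarrow> G z i = z i"
proof -
  define X where "X n = (G ^^ n) a" for n
  have X_Suc: "X (Suc n) = G (X n)" for n
    by (simp add: X_def)
  have X_box: "X n i \<in> {a i..b i}" if "i \<in> S" for n i
    using that
  proof (induction n arbitrary: i)
    case 0
    then show ?case using ab by (simp add: X_def)
  next
    case (Suc n)
    then show ?case unfolding X_Suc by (intro self)
  qed
  define M where "M = (\<Sum>i\<in>S. \<bar>b i - a i\<bar>)"
  have step: "\<bar>X (Suc n) i - X n i\<bar> \<le> M * (1 / 2) ^ n" if "i \<in> S" for n i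
    using that
  proof (induction n arbitrary: i)
    case 0
    have "\<bar>b i - a i\<bar> \<le> M"
      unfolding M_def using 0 \<open>finite S\<close> by (intro member_le_sum) auto
    then show ?case
      using X_box[OF 0, of 1] X_box[OF 0, of 0] by auto
  next
    case (Suc n)
    have "\<bar>G (X (Suc n)) i - G (X n) i\<bar> \<le> M * (1 / 2) ^ n / 2"
      using X_box Suc by (intro contr) auto
    then show ?case
      by (simp add: X_Suc)
  qed
  have "convergent (\<lambda>n. X n i)" if "i \<in> S" for i
  proof -
    have "summable (\<lambda>n. X (Suc n) i - X n i)"
      by (rule summable_comparison_test[of _ "\<lambda>n. M * (1 / 2) ^ n"])
        (use step[OF that] in \<open>auto intro!: summable_mult summable_geometric\<close>)
    then have "convergent (\<lambda>n. \<Sum>k<n. X (Suc k) i - X k i)"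
      by (simp add: summable_iff_convergent)
    moreover have "(\<Sum>k<n. X (Suc k) i - X k i) = X n i - X 0 i" for n
      by (induction n) auto
    ultimately have "convergent (\<lambda>n. X n i - X 0 i)"
      by simp
    then show ?thesis
      using convergent_add[OF _ convergent_const[of "X 0 i"]] by fastforce
  qed
  then obtain z where z: "\<And>i. i \<in> S \<Longrightarrow> (\<lambda>n. X n i) \<longlonglongrightarrow> z i"
    unfolding convergent_def by metis
  have z_box: "z i \<in> {a i..b i}" if "i \<in> S" for i
    by (rule closed_sequentially[OF closed_atLeastAtMost _ z[OF that]]) (use X_box[OF that] in auto)
  have "G z i = z i" if i: "i \<in> S" for i
  proof -
    define e where "e n = (\<Sum>i\<in>S. \<bar>X n i - z i\<bar>)" for n
    have "e \<longlonglongrightarrow> (\<Sum>i\<in>S. \<bar>z i - z i\<bar>)"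
      unfolding e_def by (intro tendsto_intros z)
    then have e0: "e \<longlonglongrightarrow> 0"
      by simp
    have "\<bar>G (X n) i - G z i\<bar> \<le> e n / 2" for n
    proof (rule contr[OF X_box z_box _ i])
      fix j assume "j \<in> S"
      then show "\<bar>X n j - z j\<bar> \<le> e n"
        unfolding e_def using \<open>finite S\<close> by (intro member_le_sum) auto
    qed auto
    then have "\<bar>X (Suc n) i - G z i\<bar> \<le> e n / 2" for n
      by (simp add: X_Suc)
    then have "(\<lambda>n. X (Suc n) i - G z i) \<longlonglongrightarrow> 0"
      by (intro Lim_null_comparison[OF _ tendsto_divide_zero[OF e0, of 2]] always_eventually) auto
    moreover have "(\<lambda>n. X (Suc n) i - G z i) \<longlonglongrightarrow> z i - G z i"
      using LIMSEQ_Suc[OF z[OF i]] by (intro tendsto_intros)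
    ultimately show ?thesis
      using LIMSEQ_unique by fastforce
  qed
  then show ?thesis
    using that z_box by blast
qed

lemma abs_exp_diff_le:
  fixes x y c :: real
  assumes "x \<le> c" "y \<le> c"
  shows "\<bar>exp x - exp y\<bar> \<le> exp c * \<bar>x - y\<bar>"
proof -
  have *: "exp v - exp u \<le> exp c * (v - u)" if "u \<le> v" "v \<le> c" for u v :: real
  proof -
    have "exp v - exp u = exp v * (1 - exp (u - v))"
      by (simp add: algebra_simps flip: exp_add)
    also have "\<dots> \<le> exp v * (v - u)"
    proof (rule mult_left_mono)
      show "1 - exp (u - v) \<le> v - u"
        using exp_ge_add_one_self[of "u - v"] by linarith
    qed simp
    also have "\<dots> \<le> exp c * (v - u)"
      using that by (intro mult_right_mono) auto
    finally show ?thesis .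
  qed
  show ?thesis
    using *[of x y] *[of y x] assms by (cases "x \<le> y") auto
qed

lemma abs_ln_diff_le:
  fixes x y c :: real
  assumes "0 < c" "c \<le> x" "c \<le> y"
  shows "\<bar>ln x - ln y\<bar> \<le> \<bar>x - y\<bar> / c"
proof -
  have *: "ln v - ln u \<le> (v - u) / c" if "c \<le> u" "u \<le> v" for u v :: real
  proof -
    have "ln v - ln u = ln (v / u)"
      using that assms by (simp add: ln_div)
    also have "\<dots> \<le> v / u - 1"
      using that assms by (intro ln_le_minus_one) auto
    also have "\<dots> = (v - u) / u"
      using that assms by (simp add: field_simps)
    also have "\<dots> \<le> (v - u) / c"
      using that assms by (intro divide_left_mono) auto
    finally show ?thesis .
  qed
  show ?thesis
    using *[of x y] *[of y x] assms by (cases "x \<le> y") auto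
qed

text \<open>The equations \<open>z = z0\<close>, perturbed by monomials with real exponents \<open>l k i\<close> and small weights
  \<open>\<epsilon> k\<close>, keep a positive solution near \<open>z0\<close>: on a box around \<open>z0\<close> that stays away from the
  coordinate hyperplanes, monomials are bounded and Lipschitz, so small weights make the right-hand
  side a contraction of the box. The last clause says that the linearization at the solution is
  injective, in logarithmic coordinates \<open>s i\<close> (relative variations of \<open>z i\<close>); the same
  estimate that gives the contraction makes the diagonal part dominate. The bounds \<open>\<delta>\<close> and \<open>R\<close>
  do not depend on the weights, so that one small parameter can serve several systems.\<close>
lemma perturbed_monomial_fixed_point:
  fixes z0 :: "'i \<Rightarrow> real" and l :: "'k \<Rightarrow> 'i \<Rightarrow> real" and E :: "'i \<Rightarrow> 'k \<Rightarrow> real"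
  assumes "finite S" "finite K" and z0: "\<And>i. i \<in> S \<Longrightarrow> 0 < z0 i"
  obtains \<delta> R where "0 < \<delta>" "0 \<le> R" and
    "\<And>\<epsilon>. (\<And>k. k \<in> K \<Longrightarrow> 0 \<le> \<epsilon> k) \<Longrightarrow> (\<And>k. k \<in> K \<Longrightarrow> \<epsilon> k \<le> \<delta>) \<Longrightarrow>
      \<exists>z. (\<forall>i\<in>S. 0 < z i \<and> \<bar>ln (z i)\<bar> \<le> R) \<and> (\<forall>k\<in>K. \<bar>\<Sum>i\<in>S. l k i * ln (z i)\<bar> \<le> R) \<and>
        (\<forall>i\<in>S. z i = z0 i + (\<Sum>k\<in>K. E i k * (\<epsilon> k * exp (\<Sum>i\<in>S. l k i * ln (z i))))) \<and>
        (\<forall>s. (\<forall>i\<in>S. z i * s i = (\<Sum>k\<in>K. E i k * (\<epsilon> k * exp (\<Sum>i\<in>S. l k i * ln (z i))) * (\<Sum>i\<in>S. l k i * s i)))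
          \<longrightarrow> (\<forall>i\<in>S. s i = 0))"
proof (cases "S = {}")
  case True
  then show ?thesis
    using that[of 1 0] by simp
next
  case False
  \<comment> \<open>Half the smallest coordinate, so that every point of the box has coordinates at least \<open>c\<close>.\<close>
  define c where "c = Min (z0 ` S) / 2"
  have c: "0 < c" and cz: "\<And>i. i \<in> S \<Longrightarrow> 2 * c \<le> z0 i"
    unfolding c_def using \<open>finite S\<close> False z0 by auto
  let ?box = "\<lambda>z. \<forall>i\<in>S. z i \<in> {z0 i - c..z0 i + c}"
  let ?lin = "\<lambda>k u. \<Sum>i\<in>S. l k i * u i"
  define U where "U = (\<Sum>i\<in>S. \<bar>ln (z0 i)\<bar> + 1)"
  define L where "L = 1 + (\<Sum>k\<in>K. \<Sum>i\<in>S. \<bar>l k i\<bar>)"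
  define A where "A = 1 + (\<Sum>i\<in>S. \<Sum>k\<in>K. \<bar>E i k\<bar>)"
  have L: "(\<Sum>i\<in>S. \<bar>l k i\<bar>) \<le> L" if "k \<in> K" for k
    using member_le_sum[of k K "\<lambda>k. \<Sum>i\<in>S. \<bar>l k i\<bar>"] that \<open>finite K\<close>
    by (auto simp: L_def sum_nonneg)
  have L1: "1 \<le> L"
    by (simp add: L_def sum_nonneg)
  have A: "(\<Sum>k\<in>K. \<bar>E i k\<bar>) \<le> A" if "i \<in> S" for i
    using member_le_sum[of i S "\<lambda>i. \<Sum>k\<in>K. \<bar>E i k\<bar>"] that \<open>finite S\<close>
    by (auto simp: A_def sum_nonneg)
  have A1: "1 \<le> A"
    by (simp add: A_def sum_nonneg)
  have U0: "0 \<le> U"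
    by (simp add: U_def sum_nonneg)
  have lin_bound: "\<bar>?lin k u\<bar> \<le> L * m" if "k \<in> K" "\<And>i. i \<in> S \<Longrightarrow> \<bar>u i\<bar> \<le> m" "0 \<le> m" for k u m
  proof -
    have "\<bar>?lin k u\<bar> \<le> (\<Sum>i\<in>S. \<bar>l k i\<bar> * m)"
      by (rule order_trans[OF sum_abs sum_mono]) (simp add: abs_mult mult_left_mono that)
    also have "\<dots> \<le> L * m"
      using L[OF that(1)] that(3) by (simp add: mult_right_mono flip: sum_distrib_right)
    finally show ?thesis .
  qed
  have E_bound: "\<bar>\<Sum>k\<in>K. E i k * g k\<bar> \<le> A * m" if "i \<in> S" "\<And>k. k \<in> K \<Longrightarrow> \<bar>g k\<bar> \<le> m" "0 \<le> m" for i g m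
  proof -
    have "\<bar>\<Sum>k\<in>K. E i k * g k\<bar> \<le> (\<Sum>k\<in>K. \<bar>E i k\<bar> * m)"
      by (rule order_trans[OF sum_abs sum_mono]) (simp add: abs_mult mult_left_mono that)
    also have "\<dots> \<le> A * m"
      using A[OF that(1)] that(3) by (simp add: mult_right_mono flip: sum_distrib_right)
    finally show ?thesis .
  qed
  define R where "R = L * U"
  have UR: "U \<le> R"
    using L1 U0 mult_right_mono[of 1 L U] by (simp add: R_def)
  have box_c: "c \<le> z i" if "?box z" "i \<in> S" for z i
    using cz[OF that(2)] that by auto
  have ln_U: "\<bar>ln (z i)\<bar> \<le> U" if "?box z" "i \<in> S" for z i
  proof -
    have "\<bar>z i - z0 i\<bar> \<le> c"
      using that by (auto simp: abs_le_iff)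
    then have "\<bar>ln (z i) - ln (z0 i)\<bar> \<le> 1"
      using abs_ln_diff_le[of c "z i" "z0 i"] c box_c[OF that] cz[OF that(2)]
      by (smt (verit) divide_le_eq_1)
    moreover have "\<bar>ln (z0 i)\<bar> + 1 \<le> U"
      unfolding U_def using that \<open>finite S\<close> by (intro member_le_sum) auto
    ultimately show ?thesis
      by linarith
  qed
  have lin_R: "\<bar>?lin k (\<lambda>i. ln (z i))\<bar> \<le> R" if "?box z" "k \<in> K" for z k
    unfolding R_def using ln_U[OF that(1)] that U0 by (intro lin_bound)
  \<comment> \<open>Chosen so that the perturbation, with its Lipschitz factors, is at most half of \<open>min 1 c\<close>:
    this gives both the contraction and the invariance of the box.\<close>
  define \<delta> where "\<delta> = min 1 c / (2 * A * L * exp R)"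
  have "0 < \<delta>"
    using c A1 L1 by (auto simp: \<delta>_def)
  show ?thesis
  proof (rule that[OF \<open>0 < \<delta>\<close>, of R])
    show "0 \<le> R"
      using UR U0 by simp
    fix \<epsilon> :: "'k \<Rightarrow> real"
    assume \<epsilon>: "\<And>k. k \<in> K \<Longrightarrow> 0 \<le> \<epsilon> k" "\<And>k. k \<in> K \<Longrightarrow> \<epsilon> k \<le> \<delta>"
    let ?w = "\<lambda>z k. \<epsilon> k * exp (?lin k (\<lambda>i. ln (z i)))"
    let ?G = "\<lambda>z i. z0 i + (\<Sum>k\<in>K. E i k * ?w z k)"
    have small: "A * (\<delta> * exp R * (L * m)) = min 1 c * m / 2" for m
      using A1 L1 by (simp add: \<delta>_def field_simps)
    have w_bound: "\<bar>?w z k\<bar> \<le> \<delta> * exp R" if "?box z" "k \<in> K" for z k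
      using lin_R[OF that] \<epsilon>[OF that(2)] by (auto simp: abs_mult intro!: mult_mono)
    obtain z where zb: "\<And>i. i \<in> S \<Longrightarrow> z i \<in> {z0 i - c..z0 i + c}" and z: "\<And>i. i \<in> S \<Longrightarrow> ?G z i = z i"
    proof (rule box_contraction_fixed_point[of S "\<lambda>i. z0 i - c" "\<lambda>i. z0 i + c" ?G])
      fix z i assume b: "\<And>i. i \<in> S \<Longrightarrow> z i \<in> {z0 i - c..z0 i + c}" and i: "i \<in> S"
      have "\<bar>\<Sum>k\<in>K. E i k * ?w z k\<bar> \<le> A * (\<delta> * exp R)"
        using b \<open>0 < \<delta>\<close> by (intro E_bound[OF i] w_bound) auto
      also have "\<dots> \<le> A * (\<delta> * exp R * (L * 1))"
        using A1 mult_left_mono[of 1 L "\<delta> * exp R"] L1 \<open>0 < \<delta>\<close> by (intro mult_left_mono) auto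
      also have "\<dots> \<le> c"
        unfolding small using c by simp
      finally show "?G z i \<in> {z0 i - c..z0 i + c}"
        by auto
    next
      fix z w e i
      assume bz: "\<And>i. i \<in> S \<Longrightarrow> z i \<in> {z0 i - c..z0 i + c}"
        and bw: "\<And>i. i \<in> S \<Longrightarrow> w i \<in> {z0 i - c..z0 i + c}"
        and e: "\<And>i. i \<in> S \<Longrightarrow> \<bar>z i - w i\<bar> \<le> e" and i: "i \<in> S"
      have "0 \<le> e"
        using e[OF i] by simp
      have "\<bar>?w z k - ?w w k\<bar> \<le> \<delta> * exp R * (L * (e / c))" if k: "k \<in> K" for k
      proof -
        have "\<bar>ln (z i) - ln (w i)\<bar> \<le> e / c" if "i \<in> S" for i
        proof -
          have "\<bar>ln (z i) - ln (w i)\<bar> \<le> \<bar>z i - w i\<bar> / c"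
            using c bz bw that by (intro abs_ln_diff_le box_c) auto
          also have "\<dots> \<le> e / c"
            using e[OF that] c by (simp add: divide_right_mono)
          finally show ?thesis .
        qed
        then have "\<bar>?lin k (\<lambda>i. ln (z i) - ln (w i))\<bar> \<le> L * (e / c)"
          using k \<open>0 \<le> e\<close> c by (intro lin_bound) auto
        then have d: "\<bar>?lin k (\<lambda>i. ln (z i)) - ?lin k (\<lambda>i. ln (w i))\<bar> \<le> L * (e / c)"
          by (simp add: right_diff_distrib sum_subtractf)
        have "?lin k (\<lambda>i. ln (z i)) \<le> R" "?lin k (\<lambda>i. ln (w i)) \<le> R"
          using lin_R[of z k] lin_R[of w k] bz bw k by force+
        then have "\<bar>exp (?lin k (\<lambda>i. ln (z i))) - exp (?lin k (\<lambda>i. ln (w i)))\<bar>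
            \<le> exp R * \<bar>?lin k (\<lambda>i. ln (z i)) - ?lin k (\<lambda>i. ln (w i))\<bar>"
          by (rule abs_exp_diff_le)
        also have "\<dots> \<le> exp R * (L * (e / c))"
          using d by (intro mult_left_mono) auto
        finally have "\<epsilon> k * \<bar>exp (?lin k (\<lambda>i. ln (z i))) - exp (?lin k (\<lambda>i. ln (w i)))\<bar>
            \<le> \<delta> * (exp R * (L * (e / c)))"
          using \<epsilon>[OF k] \<open>0 < \<delta>\<close> by (intro mult_mono) auto
        then show ?thesis
          using \<epsilon>[OF k] by (simp add: abs_mult mult.assoc flip: right_diff_distrib)
      qed
      then have "\<bar>\<Sum>k\<in>K. E i k * (?w z k - ?w w k)\<bar> \<le> A * (\<delta> * exp R * (L * (e / c)))"
        using i \<open>0 \<le> e\<close> c \<open>0 < \<delta>\<close> L1 by (intro E_bound) auto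
      also have "\<dots> \<le> c * (e / c) / 2"
        unfolding small using c \<open>0 \<le> e\<close> by (intro divide_right_mono mult_right_mono) auto
      also have "\<dots> = e / 2"
        using c by simp
      finally show "\<bar>?G z i - ?G w i\<bar> \<le> e / 2"
        by (simp add: right_diff_distrib sum_subtractf)
    qed (use \<open>finite S\<close> c in auto)
    have box: "?box z"
      using zb by auto
    \<comment> \<open>At an index where \<open>\<bar>s i\<bar>\<close> is maximal, the left-hand side is at least \<open>c\<close> times
      the maximum and the right-hand side at most half of that.\<close>
    have nondeg: "\<forall>i\<in>S. s i = 0"
      if s: "\<forall>i\<in>S. z i * s i = (\<Sum>k\<in>K. E i k * ?w z k * ?lin k s)" for s
    proof -
      define m where "m = Max ((\<lambda>i. \<bar>s i\<bar>) ` S)"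
      have m: "\<bar>s i\<bar> \<le> m" if "i \<in> S" for i
        unfolding m_def using that \<open>finite S\<close> by auto
      have "m \<in> (\<lambda>i. \<bar>s i\<bar>) ` S"
        unfolding m_def using \<open>finite S\<close> False by (intro Max_in) auto
      then obtain i where i: "i \<in> S" "m = \<bar>s i\<bar>"
        by auto
      have "0 \<le> m"
        using i by simp
      have "\<bar>\<Sum>k\<in>K. E i k * (?w z k * ?lin k s)\<bar> \<le> A * (\<delta> * exp R * (L * m))"
      proof (rule E_bound[OF i(1)])
        fix k assume k: "k \<in> K"
        show "\<bar>?w z k * ?lin k s\<bar> \<le> \<delta> * exp R * (L * m)"
          unfolding abs_mult[of "?w z k"]
          using w_bound[OF box k] lin_bound[OF k m \<open>0 \<le> m\<close>] \<open>0 < \<delta>\<close> by (intro mult_mono) auto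
      qed (use \<open>0 \<le> m\<close> \<open>0 < \<delta>\<close> L1 in auto)
      also have "\<dots> \<le> c * m / 2"
        unfolding small using \<open>0 \<le> m\<close> c by (auto simp: mult_right_mono)
      finally have "\<bar>z i * s i\<bar> \<le> c * m / 2"
        using s i(1) by (simp add: mult.assoc)
      moreover have "c * m \<le> \<bar>z i * s i\<bar>"
        using box_c[OF box i(1)] c i(2) by (auto simp: abs_mult intro!: mult_right_mono)
      ultimately have "c * m \<le> 0"
        by linarith
      then have "m = 0"
        using c \<open>0 \<le> m\<close> by (simp add: mult_le_0_iff)
      then show ?thesis
        using m by force
    qed
    have "0 < z i \<and> \<bar>ln (z i)\<bar> \<le> R" if "i \<in> S" for i
      using box_c[OF box that] c ln_U[OF box that] UR by auto
    with z lin_R[OF box] nondeg show "\<exists>z. (\<forall>i\<in>S. 0 < z i \<and> \<bar>ln (z i)\<bar> \<le> R) \<and> (\<forall>k\<in>K. \<bar>?lin k (\<lambda>i. ln (z i))\<bar> \<le> R) \<and>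
        (\<forall>i\<in>S. z i = ?G z i) \<and>
        (\<forall>s. (\<forall>i\<in>S. z i * s i = (\<Sum>k\<in>K. E i k * ?w z k * ?lin k s)) \<longrightarrow> (\<forall>i\<in>S. s i = 0))"
      by (intro exI[of _ z] conjI) auto
  qed
qed

section \<open>Oriented matrices\<close>

lemma pick_Compl_singleton: "pick (- {c}) j = (if j < c then j else Suc j)"
proof (induction j)
  case 0
  have "(LEAST a. a \<in> - {c}) = (if 0 < c then 0 else Suc 0)"
    by (rule Least_equality) auto
  then show ?case by simp
next
  case (Suc j)
  have "(LEAST a. a \<in> - {c} \<and> a > (if j < c then j else Suc j)) = (if Suc j < c then Suc j else Suc (Suc j))"
    by (rule Least_equality) (auto split: if_splits)
  then show ?case by (simp only: pick.simps Suc.IH)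
qed

lemma submatrix_Compl_singleton:
  assumes "M \<in> carrier_mat d (d + 1)" "c \<le> d"
  shows "submatrix M UNIV (- {c}) = mat d d (\<lambda>(i, j). M $$ (i, if j < c then j else Suc j))"
proof -
  have "{j. j < d + 1 \<and> j \<in> - {c}} = {..d} - {c}"
    by auto
  then have "card {j. j < d + 1 \<and> j \<in> - {c}} = d"
    using assms(2) by simp
  then show ?thesis
    using assms(1) by (auto simp: submatrix_def pick_UNIV pick_Compl_singleton intro!: cong_mat)
qed

text \<open>Repeating row \<open>i\<close> on top of \<open>M\<close> gives a square matrix with determinant 0, whose expansion along
  the top row is the claimed sum.\<close>
lemma minors_kernel:
  assumes M: "M \<in> carrier_mat d (d + 1)" and "i < d"
  shows "(\<Sum>c\<le>d. M $$ (i, c) * ((-1) ^ c * minor M c)) = 0"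
proof -
  define N where "N = mat (d + 1) (d + 1) (\<lambda>(r, c). M $$ (if r = 0 then i else r - 1, c))"
  have N: "N \<in> carrier_mat (d + 1) (d + 1)"
    by (simp add: N_def)
  have "row N 0 = row N (Suc i)"
    using \<open>i < d\<close> by (auto simp: N_def)
  then have "det N = 0"
    using \<open>i < d\<close> by (intro det_identical_rows[OF N, of 0 "Suc i"]) auto
  moreover have "cofactor N 0 c = (-1) ^ c * minor M c" if "c \<le> d" for c
  proof -
    have "mat_delete N 0 c = mat d d (\<lambda>(i, j). M $$ (i, if j < c then j else Suc j))"
      using that by (auto simp: mat_delete_def N_def intro!: cong_mat)
    then show ?thesis
      using submatrix_Compl_singleton[OF M that] by (simp add: cofactor_def minor_def)
  qed
  moreover have "N $$ (0, c) = M $$ (i, c)" if "c \<le> d" for c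
    using that by (simp add: N_def)
  ultimately show ?thesis
    using laplace_expansion_row[OF N, of 0] by (simp add: lessThan_Suc_atMost)
qed

text \<open>What orientation is used for. The alternating minors are a kernel vector, positive up to one
  common sign; it is the positive solution of the linear system in the monomials of the simplex.
  The last minor is nonzero, so the first \<open>d\<close> columns have an inverse \<open>B\<close>. Sums over indices
  rather than matrix products are stated, to be reindexed by the vertices of a simplex.\<close>
lemma oriented_imp_kernel_and_inverse:
  assumes "oriented d M"
  obtains y B where "\<And>c. c \<le> d \<Longrightarrow> 0 < y c" "\<And>i. i < d \<Longrightarrow> (\<Sum>c\<le>d. M $$ (i, c) * y c) = 0"
    "\<And>i i'. i < d \<Longrightarrow> i' < d \<Longrightarrow> (\<Sum>c<d. M $$ (i, c) * B c i') = (if i = i' then 1 else 0)"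
    "\<And>c c'. c < d \<Longrightarrow> c' < d \<Longrightarrow> (\<Sum>i<d. B c i * M $$ (i, c')) = (if c = c' then 1 else (0::real))"
proof -
  have M: "M \<in> carrier_mat d (d + 1)"
    and s: "(\<forall>c\<le>d. (-1) ^ c * minor M c > 0) \<or> (\<forall>c\<le>d. (-1) ^ c * minor M c < 0)"
    using assms by (auto simp: oriented_def)
  define e :: real where "e = (if \<forall>c\<le>d. (-1) ^ c * minor M c > 0 then 1 else -1)"
  define y where "y c = e * ((-1) ^ c * minor M c)" for c
  have pos: "0 < y c" if "c \<le> d" for c
    using s that by (auto simp: y_def e_def)
  have ker: "(\<Sum>c\<le>d. M $$ (i, c) * y c) = 0" if "i < d" for i
  proof -
    have "(\<Sum>c\<le>d. M $$ (i, c) * y c) = e * (\<Sum>c\<le>d. M $$ (i, c) * ((-1) ^ c * minor M c))"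
      by (simp add: y_def sum_distrib_left mult_ac)
    then show ?thesis
      using minors_kernel[OF M that] by simp
  qed
  define A where "A = submatrix M UNIV (- {d})"
  have A_eq: "A = mat d d (\<lambda>(i, c). M $$ (i, c))"
    unfolding A_def submatrix_Compl_singleton[OF M order_refl] by (rule cong_mat) auto
  have A: "A \<in> carrier_mat d d"
    by (simp add: A_eq)
  have "det A \<noteq> 0"
    using pos[of d] by (auto simp: y_def minor_def A_def)
  from det_non_zero_imp_unit[OF A this, of "()"]
  obtain B where B: "B \<in> carrier_mat d d" "B * A = 1\<^sub>m d" "A * B = 1\<^sub>m d"
    unfolding Units_def ring_mat_def by auto
  have AB: "(\<Sum>c<d. M $$ (i, c) * B $$ (c, i')) = (if i = i' then 1 else 0)" if "i < d" "i' < d" for i i'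
  proof -
    have "(A * B) $$ (i, i') = (\<Sum>c<d. M $$ (i, c) * B $$ (c, i'))"
      using A B(1) that by (simp add: scalar_prod_def A_eq atLeast0LessThan)
    then show ?thesis
      using that by (simp add: B(3))
  qed
  have BA: "(\<Sum>i<d. B $$ (c, i) * M $$ (i, c')) = (if c = c' then 1 else 0)" if "c < d" "c' < d" for c c'
  proof -
    have "(B * A) $$ (c, c') = (\<Sum>i<d. B $$ (c, i) * M $$ (i, c'))"
      using A B(1) that by (simp add: scalar_prod_def A_eq atLeast0LessThan)
    then show ?thesis
      using that by (simp add: B(2))
  qed
  show ?thesis
    by (rule that[of y "\<lambda>c i. B $$ (c, i)"]) (use pos ker AB BA in auto)
qed

text \<open>The same for the columns of \<open>C\<close> labelled by a simplex; \<open>j0\<close> is the largest vertex.\<close>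
lemma oriented_simplex_imp_kernel_and_inverse:
  assumes C: "C \<in> carrier_mat d n" and \<sigma>: "\<sigma> \<subseteq> {1..n}" "card \<sigma> = d + 1"
    and or: "oriented d (submatrix C UNIV ((\<lambda>v. v - 1) ` \<sigma>))"
  obtains y B j0 where "j0 \<in> \<sigma>" "\<And>j. j \<in> \<sigma> \<Longrightarrow> 0 < y j"
    "\<And>i. i < d \<Longrightarrow> (\<Sum>j\<in>\<sigma>. C $$ (i, j - 1) * y j) = 0"
    "\<And>i i'. i < d \<Longrightarrow> i' < d \<Longrightarrow> (\<Sum>j\<in>\<sigma> - {j0}. C $$ (i, j - 1) * B j i') = (if i = i' then 1 else 0)"
    "\<And>j j'. j \<in> \<sigma> - {j0} \<Longrightarrow> j' \<in> \<sigma> - {j0} \<Longrightarrow>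
       (\<Sum>i<d. B j i * C $$ (i, j' - 1)) = (if j = j' then 1 else (0::real))"
proof -
  define J where "J = (\<lambda>v. v - 1 :: nat) ` \<sigma>"
  define M where "M = submatrix C UNIV J"
  have inj: "inj_on (\<lambda>v. v - 1 :: nat) \<sigma>"
    using \<sigma>(1) by (intro inj_on_diff_nat) auto
  have "finite \<sigma>"
    using \<sigma>(1) finite_subset by blast
  have "v - 1 < n" if "v \<in> \<sigma>" for v
    using subsetD[OF \<sigma>(1) that] by (cases v) auto
  then have J: "finite J" "card J = d + 1" "J \<subseteq> {..<n}"
    using \<sigma> \<open>finite \<sigma>\<close> card_image[OF inj] by (auto simp: J_def)
  define f where "f c = Suc (pick J c)" for c
  have f_mem: "f c \<in> \<sigma>" if "c \<le> d" for c
  proof -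
    have "pick J c \<in> J"
      using that J by (intro pick_in_set_le) auto
    then show ?thesis
      using \<sigma>(1) by (auto simp: f_def J_def)
  qed
  have f_inj: "inj_on f {..d}"
  proof (rule linorder_inj_onI')
    fix c c' assume "c \<in> {..d}" "c' \<in> {..d}" "c < c'"
    then show "f c \<noteq> f c'"
      using pick_mono_le[of c' J c] J(2) by (auto simp: f_def)
  qed
  have bij: "bij_betw f {..d} \<sigma>"
    unfolding bij_betw_def
  proof
    show "f ` {..d} = \<sigma>"
      using f_mem \<sigma>(2) \<open>finite \<sigma>\<close> by (intro card_subset_eq) (auto simp: card_image[OF f_inj])
  qed (rule f_inj)
  have "{..<d} = {..d} - {d}"
    by auto
  then have bij': "bij_betw f {..<d} (\<sigma> - {f d})"
    using inj_on_image_set_diff[OF f_inj, of "{..d}" "{d}"] bij inj_on_subset[OF f_inj, of "{..<d}"]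
    by (simp add: bij_betw_def)
  have "{j. j < n \<and> j \<in> J} = J"
    using J by auto
  then have M_index: "M $$ (i, c) = C $$ (i, f c - 1)" if "i < d" "c \<le> d" for i c
    using C that J unfolding M_def by (subst submatrix_index) (auto simp: f_def pick_UNIV)
  obtain y B where y: "\<And>c. c \<le> d \<Longrightarrow> 0 < y c" "\<And>i. i < d \<Longrightarrow> (\<Sum>c\<le>d. M $$ (i, c) * y c) = 0"
    and B: "\<And>i i'. i < d \<Longrightarrow> i' < d \<Longrightarrow> (\<Sum>c<d. M $$ (i, c) * B c i') = (if i = i' then 1 else 0)"
    "\<And>c c'. c < d \<Longrightarrow> c' < d \<Longrightarrow> (\<Sum>i<d. B c i * M $$ (i, c')) = (if c = c' then 1 else (0::real))"
    by (rule oriented_imp_kernel_and_inverse[OF or[folded J_def, folded M_def]]) blast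
  define g where "g = the_inv_into {..d} f"
  have gf: "g (f c) = c" if "c \<le> d" for c
    unfolding g_def using that f_inj by (intro the_inv_into_f_f) auto
  show ?thesis
  proof (rule that[of "f d" "\<lambda>j. y (g j)" "\<lambda>j. B (g j)"])
    show "f d \<in> \<sigma>"
      using f_mem by simp
    show "0 < y (g j)" if "j \<in> \<sigma>" for j
      using that bij gf y(1) by (auto simp: bij_betw_def)
    show "(\<Sum>j\<in>\<sigma>. C $$ (i, j - 1) * y (g j)) = 0" if "i < d" for i
      using y(2)[OF that] that
      by (subst sum.reindex_bij_betw[OF bij, symmetric]) (simp add: M_index gf)
    show "(\<Sum>j\<in>\<sigma> - {f d}. C $$ (i, j - 1) * B (g j) i') = (if i = i' then 1 else 0)"
      if "i < d" "i' < d" for i i'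
      using B(1)[OF that] that
      by (subst sum.reindex_bij_betw[OF bij', symmetric]) (simp add: M_index gf)
    show "(\<Sum>i<d. B (g j) i * C $$ (i, j' - 1)) = (if j = j' then 1 else 0)"
      if "j \<in> \<sigma> - {f d}" "j' \<in> \<sigma> - {f d}" for j j'
    proof -
      have "j \<in> f ` {..<d}" "j' \<in> f ` {..<d}"
        using that unfolding bij_betw_imp_surj_on[OF bij'] .
      then obtain c c' where c: "c < d" "c' < d" "j = f c" "j' = f c'"
        by blast
      then have "j = j' \<longleftrightarrow> c = c'"
        using f_inj by (auto simp: inj_on_def)
      then show ?thesis
        using B(2)[OF c(1,2)] c by (simp add: M_index gf)
    qed
  qed
qed

section \<open>Solutions near an oriented simplex\<close>

definition node_poly :: "nat set \<Rightarrow> real poly" where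
  "node_poly \<sigma> = (\<Prod>v\<in>\<sigma>. [:- real v, 1:])"

lemma degree_node_poly: "degree (node_poly \<sigma>) = card \<sigma>"
  unfolding node_poly_def by (subst degree_prod_eq_sum_degree) auto

lemma lead_coeff_node_poly: "coeff (node_poly \<sigma>) (card \<sigma>) = 1"
  using lead_coeff_prod[of "\<lambda>v. [:- real v, 1:]" \<sigma>] unfolding degree_node_poly[symmetric]
  by (simp add: node_poly_def)

lemma poly_node_poly: "poly (node_poly \<sigma>) x = (\<Prod>v\<in>\<sigma>. x - real v)"
  by (simp add: node_poly_def poly_prod)

text \<open>Lift the vertex \<open>(j, j\<^sup>2, \<dots>, j\<^sup>d)\<close> to height \<open>j ^ Suc d\<close>. The polynomial \<open>monom 1 (Suc d) -
  node_poly \<sigma>\<close> agrees with the height on \<open>\<sigma>\<close> and, having degree at most \<open>d\<close>, is an affine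
  function on the moment curve; \<open>node_poly \<sigma>\<close> is the height of a lifted vertex above the
  hyperplane spanned by the lifted simplex.\<close>
lemma degree_monom_minus_node_poly: "degree (monom 1 (Suc d) - node_poly \<sigma>) \<le> d" if "card \<sigma> = Suc d"
proof (rule degree_le, intro allI impI)
  fix i assume "d < i"
  then show "coeff (monom 1 (Suc d) - node_poly \<sigma>) i = 0"
    using that lead_coeff_node_poly[of \<sigma>] degree_node_poly[of \<sigma>]
    by (cases "i = Suc d") (auto simp: coeff_eq_0)
qed

definition lagrange_basis :: "nat set \<Rightarrow> nat \<Rightarrow> real poly" where
  "lagrange_basis \<sigma> i = (\<Prod>v\<in>\<sigma> - {i}. smult (1 / (real i - real v)) [:- real v, 1:])"

lemma poly_lagrange_basis:
  assumes "finite \<sigma>" "i \<in> \<sigma>" "j \<in> \<sigma>"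
  shows "poly (lagrange_basis \<sigma> i) (real j) = (if i = j then 1 else 0)"
  using assms by (auto simp: lagrange_basis_def poly_prod diff_divide_distrib[symmetric] intro!: prod.neutral)

lemma degree_lagrange_basis:
  assumes "finite \<sigma>" "i \<in> \<sigma>"
  shows "degree (lagrange_basis \<sigma> i) < card \<sigma>"
proof -
  have "degree (lagrange_basis \<sigma> i) \<le> (\<Sum>v\<in>\<sigma> - {i}. degree (smult (1 / (real i - real v)) [:- real v, 1:]))"
    unfolding lagrange_basis_def using assms(1) by (intro degree_prod_sum_le[THEN order_trans]) auto
  also have "\<dots> \<le> (\<Sum>v\<in>\<sigma> - {i}. 1)"
    by (intro sum_mono) auto
  also have "\<dots> < card \<sigma>"
    using card_Suc_Diff1[OF assms] by simp
  finally show ?thesis .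
qed

definition lagrange_interpolant :: "nat set \<Rightarrow> (nat \<Rightarrow> real) \<Rightarrow> real poly" where
  "lagrange_interpolant \<sigma> y = (\<Sum>i\<in>\<sigma>. smult (y i) (lagrange_basis \<sigma> i))"

lemma poly_lagrange_interpolant:
  "poly (lagrange_interpolant \<sigma> y) x = (\<Sum>i\<in>\<sigma>. poly (lagrange_basis \<sigma> i) x * y i)"
  by (simp add: lagrange_interpolant_def poly_sum mult.commute)

lemma poly_lagrange_interpolant_node:
  assumes "finite \<sigma>" "j \<in> \<sigma>"
  shows "poly (lagrange_interpolant \<sigma> y) (real j) = y j"
proof -
  have "poly (lagrange_interpolant \<sigma> y) (real j) = (\<Sum>i\<in>\<sigma>. if i = j then y i else 0)"
    unfolding poly_lagrange_interpolant using assms by (intro sum.cong) (auto simp: poly_lagrange_basis)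
  then show ?thesis
    using assms by simp
qed

lemma degree_lagrange_interpolant:
  assumes "finite \<sigma>" "card \<sigma> = Suc d"
  shows "degree (lagrange_interpolant \<sigma> y) \<le> d"
  unfolding lagrange_interpolant_def
proof (rule degree_sum_le[OF assms(1)])
  fix i assume "i \<in> \<sigma>"
  then show "degree (smult (y i) (lagrange_basis \<sigma> i)) \<le> d"
    using degree_lagrange_basis[OF assms(1), of i] assms(2) degree_smult_le[of "y i" "lagrange_basis \<sigma> i"] by linarith
qed

lemma poly_eq_0_if_vanishes_on:
  fixes q :: "real poly"
  assumes "degree q < card \<sigma>" "\<And>j. j \<in> \<sigma> \<Longrightarrow> poly q (real j) = 0"
  shows "q = 0"
proof (rule ccontr)
  assume "q \<noteq> 0"
  have "card \<sigma> = card (real ` \<sigma>)"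
    by (simp add: card_image inj_on_def)
  also have "\<dots> \<le> card {x. poly q x = 0}"
    using assms(2) poly_roots_finite[OF \<open>q \<noteq> 0\<close>] by (intro card_mono) auto
  also have "\<dots> \<le> degree q"
    by (rule card_poly_roots_bound[OF \<open>q \<noteq> 0\<close>])
  finally show False
    using assms(1) by simp
qed

lemma lagrange_interpolation:
  assumes "finite \<sigma>" "card \<sigma> = Suc d" "degree q \<le> d"
  shows "lagrange_interpolant \<sigma> (\<lambda>i. poly q (real i)) = q"
proof -
  have "lagrange_interpolant \<sigma> (\<lambda>i. poly q (real i)) - q = 0"
  proof (rule poly_eq_0_if_vanishes_on)
    show "degree (lagrange_interpolant \<sigma> (\<lambda>i. poly q (real i)) - q) < card \<sigma>"
      unfolding assms(2) less_Suc_eq_le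
      by (rule degree_diff_le[OF degree_lagrange_interpolant[OF assms(1,2)] assms(3)])
  qed (simp add: poly_lagrange_interpolant_node assms(1))
  then show ?thesis
    by simp
qed

text \<open>With \<open>w j\<close> the value of the \<open>j\<close>-th monomial at a point, times the coefficient common to all
  equations, the first clause says that the point solves the system. A tangent vector at the point,
  written in logarithmic coordinates, multiplies the \<open>j\<close>-th monomial by the value at \<open>j\<close> of a
  polynomial of degree at most \<open>d\<close> without constant term, so the second clause is the
  invertibility of the Jacobian; the constants \<open>q\<close> are solutions by the first clause. Both clauses
  are invariant under scaling \<open>w\<close>, so a common factor of the monomials may be dropped.\<close>
definition nondegenerate_weights :: "real mat \<Rightarrow> nat \<Rightarrow> nat \<Rightarrow> (nat \<Rightarrow> real) \<Rightarrow> bool" where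
  "nondegenerate_weights C n d w \<longleftrightarrow>
     (\<forall>i<d. (\<Sum>j=1..n. C $$ (i, j - 1) * w j) = 0) \<and>
     (\<forall>q :: real poly. degree q \<le> d \<longrightarrow>
       (\<forall>i<d. (\<Sum>j=1..n. C $$ (i, j - 1) * w j * poly q (real j)) = 0) \<longrightarrow> degree q = 0)"

text \<open>As \<open>s\<close> grows, the monomials outside \<open>\<sigma>\<close> become negligible, and the limit system in the monomials
  of \<open>\<sigma>\<close> is linear, with the positive kernel vector \<open>y\<close> as its solution. The unknowns are the values
  \<open>z i\<close> of the monomials of \<open>\<sigma>\<close>; the other monomials are then monomials in \<open>z\<close> with the values of the
  Lagrange basis as real exponents, because the logarithms of all the monomials are the values of
  one polynomial of degree at most \<open>d\<close>. Multiplying by the inverse \<open>B\<close> brings the system into the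
  form of the perturbed fixed-point equation. The bound \<open>R\<close> is uniform in \<open>s\<close>; it is what keeps
  the solutions belonging to different simplices apart.\<close>
lemma oriented_simplex_persists:
  fixes C :: "real mat" and p :: "nat \<Rightarrow> real"
  assumes C: "C \<in> carrier_mat d n" and \<sigma>: "\<sigma> \<subseteq> {1..n}" "card \<sigma> = d + 1"
    and or: "oriented d (submatrix C UNIV ((\<lambda>v. v - 1) ` \<sigma>))"
    and p0: "\<And>j. j \<in> \<sigma> \<Longrightarrow> p j = 0" and p1: "\<And>j. j \<in> {1..n} - \<sigma> \<Longrightarrow> 1 \<le> p j"
  obtains s0 R where "\<And>s. s0 \<le> s \<Longrightarrow> \<exists>r. degree r \<le> d \<and> (\<forall>j\<in>{1..n}. \<bar>poly r (real j)\<bar> \<le> R) \<and>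
    nondegenerate_weights C n d (\<lambda>j. exp (poly r (real j) - s * p j))"
proof -
  obtain y B j0 where j0: "j0 \<in> \<sigma>" and y: "\<And>j. j \<in> \<sigma> \<Longrightarrow> 0 < y j"
    "\<And>i. i < d \<Longrightarrow> (\<Sum>j\<in>\<sigma>. C $$ (i, j - 1) * y j) = 0"
    and CB: "\<And>i i'. i < d \<Longrightarrow> i' < d \<Longrightarrow> (\<Sum>j\<in>\<sigma> - {j0}. C $$ (i, j - 1) * B j i') = (if i = i' then 1 else 0)"
    and BC: "\<And>j j'. j \<in> \<sigma> - {j0} \<Longrightarrow> j' \<in> \<sigma> - {j0} \<Longrightarrow>
       (\<Sum>i<d. B j i * C $$ (i, j' - 1)) = (if j = j' then 1 else (0::real))"
    by (rule oriented_simplex_imp_kernel_and_inverse[OF C \<sigma> or]) blast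
  have fin: "finite \<sigma>"
    using \<sigma>(1) finite_subset by blast
  define K where "K = {1..n} - \<sigma>"
  have split: "(\<Sum>j=1..n. g j) = (\<Sum>j\<in>\<sigma>. g j) + (\<Sum>k\<in>K. g k)" for g :: "nat \<Rightarrow> real"
    unfolding K_def using sum.subset_diff[OF \<sigma>(1), of g] by (simp add: add.commute)
  \<comment> \<open>The system is homogeneous in the monomials; the value at \<open>j0\<close> is fixed to \<open>y j0\<close> by not perturbing it.\<close>
  define E where "E j k = (if j = j0 then 0 else - (\<Sum>i<d. B j i * C $$ (i, k - 1)))" for j k
  define l where "l k i = poly (lagrange_basis \<sigma> i) (real k)" for k i :: nat
  obtain \<delta> R where \<delta>: "0 < \<delta>" and "0 \<le> R" and fp:
    "\<And>\<epsilon>. (\<And>k. k \<in> K \<Longrightarrow> 0 \<le> \<epsilon> k) \<Longrightarrow> (\<And>k. k \<in> K \<Longrightarrow> \<epsilon> k \<le> \<delta>) \<Longrightarrow>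
      \<exists>z. (\<forall>i\<in>\<sigma>. 0 < z i \<and> \<bar>ln (z i)\<bar> \<le> R) \<and> (\<forall>k\<in>K. \<bar>\<Sum>i\<in>\<sigma>. l k i * ln (z i)\<bar> \<le> R) \<and>
        (\<forall>i\<in>\<sigma>. z i = y i + (\<Sum>k\<in>K. E i k * (\<epsilon> k * exp (\<Sum>i\<in>\<sigma>. l k i * ln (z i))))) \<and>
        (\<forall>s. (\<forall>i\<in>\<sigma>. z i * s i = (\<Sum>k\<in>K. E i k * (\<epsilon> k * exp (\<Sum>i\<in>\<sigma>. l k i * ln (z i))) * (\<Sum>i\<in>\<sigma>. l k i * s i)))
          \<longrightarrow> (\<forall>i\<in>\<sigma>. s i = 0))"
    by (rule perturbed_monomial_fixed_point[OF fin, of K y l E]) (use y(1) in \<open>auto simp: K_def\<close>)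
  show ?thesis
  proof (rule that[of "max 0 (- ln \<delta>)" R])
    fix s assume s: "max 0 (- ln \<delta>) \<le> s"
    have \<epsilon>: "exp (- (s * p k)) \<le> \<delta>" if "k \<in> K" for k
    proof -
      have "s * 1 \<le> s * p k"
        using s p1 that by (intro mult_left_mono) (auto simp: K_def)
      then have "- (s * p k) \<le> ln \<delta>"
        using s by auto
      then show ?thesis
        using \<delta> by (simp add: ln_ge_iff)
    qed
    obtain z where z: "\<And>i. i \<in> \<sigma> \<Longrightarrow> 0 < z i" "\<And>i. i \<in> \<sigma> \<Longrightarrow> \<bar>ln (z i)\<bar> \<le> R"
      "\<And>k. k \<in> K \<Longrightarrow> \<bar>\<Sum>i\<in>\<sigma>. l k i * ln (z i)\<bar> \<le> R"
      "\<And>i. i \<in> \<sigma> \<Longrightarrow> z i = y i + (\<Sum>k\<in>K. E i k * (exp (- (s * p k)) * exp (\<Sum>i\<in>\<sigma>. l k i * ln (z i))))"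
      "\<And>u. (\<And>i. i \<in> \<sigma> \<Longrightarrow> z i * u i = (\<Sum>k\<in>K. E i k * (exp (- (s * p k)) * exp (\<Sum>i\<in>\<sigma>. l k i * ln (z i))) * (\<Sum>i\<in>\<sigma>. l k i * u i)))
          \<Longrightarrow> (\<forall>i\<in>\<sigma>. u i = 0)"
      by (rule exE[OF fp[of "\<lambda>k. exp (- (s * p k))", OF exp_ge_zero \<epsilon>]])
        (assumption, elim conjE, blast)
    define r where "r = lagrange_interpolant \<sigma> (\<lambda>i. ln (z i))"
    define w where "w j = exp (poly r (real j) - s * p j)" for j
    have r_K: "poly r (real k) = (\<Sum>i\<in>\<sigma>. l k i * ln (z i))" for k
      by (simp add: r_def poly_lagrange_interpolant l_def)
    have r_\<sigma>: "poly r (real j) = ln (z j)" if "j \<in> \<sigma>" for j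
      unfolding r_def by (rule poly_lagrange_interpolant_node[OF fin that])
    have w_\<sigma>: "w j = z j" if "j \<in> \<sigma>" for j
      using that z(1) p0 by (simp add: w_def r_\<sigma>)
    have w_K: "exp (- (s * p k)) * exp (\<Sum>i\<in>\<sigma>. l k i * ln (z i)) = w k" for k
      by (simp add: w_def r_K flip: exp_add)
    have "degree r \<le> d"
      unfolding r_def using degree_lagrange_interpolant[OF fin] \<sigma>(2) by simp
    moreover have "\<bar>poly r (real j)\<bar> \<le> R" if "j \<in> {1..n}" for j
      using z(2,3) r_\<sigma> r_K that by (cases "j \<in> \<sigma>") (auto simp: K_def)
    moreover have "(\<Sum>j=1..n. C $$ (i, j - 1) * w j) = 0" if i: "i < d" for i
    proof -
      have CE: "(\<Sum>j\<in>\<sigma>. C $$ (i, j - 1) * E j k) = - C $$ (i, k - 1)" for k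
      proof -
        have "(\<Sum>j\<in>\<sigma>. C $$ (i, j - 1) * E j k) = (\<Sum>j\<in>\<sigma> - {j0}. C $$ (i, j - 1) * E j k)"
          using fin by (intro sum.mono_neutral_right) (auto simp: E_def)
        also have "\<dots> = - (\<Sum>j\<in>\<sigma> - {j0}. \<Sum>i'<d. C $$ (i, j - 1) * B j i' * C $$ (i', k - 1))"
          by (simp add: E_def sum_distrib_left mult.assoc flip: sum_negf)
        also have "\<dots> = - (\<Sum>i'<d. (\<Sum>j\<in>\<sigma> - {j0}. C $$ (i, j - 1) * B j i') * C $$ (i', k - 1))"
          by (subst sum.swap) (simp add: sum_distrib_right)
        also have "\<dots> = - (\<Sum>i'<d. if i = i' then C $$ (i', k - 1) else 0)"
          using CB[OF i] by (intro arg_cong[of _ _ uminus] sum.cong) auto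
        finally show ?thesis
          using i by simp
      qed
      have "(\<Sum>j\<in>\<sigma>. C $$ (i, j - 1) * w j)
          = (\<Sum>j\<in>\<sigma>. C $$ (i, j - 1) * y j + (\<Sum>k\<in>K. C $$ (i, j - 1) * E j k * w k))"
      proof (rule sum.cong[OF refl])
        fix j assume j: "j \<in> \<sigma>"
        have "w j = y j + (\<Sum>k\<in>K. E j k * w k)"
          using z(4)[OF j] unfolding w_K w_\<sigma>[OF j] .
        then show "C $$ (i, j - 1) * w j = C $$ (i, j - 1) * y j + (\<Sum>k\<in>K. C $$ (i, j - 1) * E j k * w k)"
          by (simp add: distrib_left sum_distrib_left mult.assoc)
      qed
      also have "\<dots> = (\<Sum>k\<in>K. (\<Sum>j\<in>\<sigma>. C $$ (i, j - 1) * E j k) * w k)"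
        using y(2)[OF i] by (simp add: sum.distrib sum.swap[of _ K \<sigma>] sum_distrib_right)
      also have "\<dots> = - (\<Sum>k\<in>K. C $$ (i, k - 1) * w k)"
        unfolding CE by (simp add: sum_negf)
      finally show ?thesis
        unfolding split by simp
    qed
    moreover have "degree q = 0" if q: "degree q \<le> d"
      and eq: "\<And>i. i < d \<Longrightarrow> (\<Sum>j=1..n. C $$ (i, j - 1) * w j * poly q (real j)) = 0"
      and eq0: "\<And>i. i < d \<Longrightarrow> (\<Sum>j=1..n. C $$ (i, j - 1) * w j) = 0" for q
    proof -
      \<comment> \<open>By homogeneity \<open>q\<close> may be replaced by a polynomial that vanishes at \<open>j0\<close>, where there is no perturbation.\<close>
      define u where "u = q - [:poly q (real j0):]"
      have u0: "poly u (real j0) = 0"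
        by (simp add: u_def)
      have u_deg: "degree u \<le> d"
        unfolding u_def using q by (intro degree_diff_le) auto
      have u_eq: "(\<Sum>j=1..n. C $$ (i, j - 1) * (w j * poly u (real j))) = 0" if "i < d" for i
      proof -
        have "(\<Sum>j=1..n. C $$ (i, j - 1) * (w j * poly u (real j))) =
            (\<Sum>j=1..n. C $$ (i, j - 1) * w j * poly q (real j)) - (\<Sum>j=1..n. C $$ (i, j - 1) * w j) * poly q (real j0)"
          by (simp add: u_def right_diff_distrib sum_subtractf sum_distrib_right mult.assoc)
        then show ?thesis
          using eq[OF that] eq0[OF that] by simp
      qed
      have u_lin: "(\<Sum>i\<in>\<sigma>. l k i * poly u (real i)) = poly u (real k)" for k
        using lagrange_interpolation[OF fin _ u_deg] \<sigma>(2) poly_lagrange_interpolant[of \<sigma> "\<lambda>i. poly u (real i)" "real k"]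
        by (simp add: l_def)
      have "\<forall>i\<in>\<sigma>. poly u (real i) = 0"
      proof (rule z(5), unfold w_K u_lin)
        fix j assume j: "j \<in> \<sigma>"
        show "z j * poly u (real j) = (\<Sum>k\<in>K. E j k * w k * poly u (real k))"
        proof (cases "j = j0")
          case True
          then show ?thesis
            by (simp add: u0 E_def)
        next
          case False
          have "(\<Sum>i<d. B j i * (\<Sum>j'=1..n. C $$ (i, j' - 1) * (w j' * poly u (real j')))) = 0"
            using u_eq by simp
          then have "(\<Sum>j'=1..n. (\<Sum>i<d. B j i * C $$ (i, j' - 1)) * (w j' * poly u (real j'))) = 0"
            by (simp add: sum_distrib_left sum_distrib_right sum.swap[of _ "{Suc 0..n}"] mult.assoc)
          moreover have "(\<Sum>k\<in>K. (\<Sum>i<d. B j i * C $$ (i, k - 1)) * (w k * poly u (real k)))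
              = - (\<Sum>k\<in>K. E j k * w k * poly u (real k))"
            using False by (simp add: E_def sum_negf mult.assoc)
          moreover have "(\<Sum>j'\<in>\<sigma>. (\<Sum>i<d. B j i * C $$ (i, j' - 1)) * (w j' * poly u (real j')))
              = (\<Sum>j'\<in>\<sigma>. if j = j' then w j' * poly u (real j') else 0)"
          proof (rule sum.cong[OF refl])
            fix j' assume "j' \<in> \<sigma>"
            then show "(\<Sum>i<d. B j i * C $$ (i, j' - 1)) * (w j' * poly u (real j'))
              = (if j = j' then w j' * poly u (real j') else 0)"
              using BC[of j j'] j False u0 by (cases "j' = j0") auto
          qed
          ultimately show ?thesis
            using j fin w_\<sigma>[OF j] unfolding split by simp
        qed
      qed
      then have "u = 0"
        using u_deg \<sigma>(2) by (intro poly_eq_0_if_vanishes_on[of u \<sigma>]) auto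
      then have "q = [:poly q (real j0):]"
        by (simp add: u_def)
      then show ?thesis
        by (metis degree_pCons_0)
    qed
    ultimately show "\<exists>r. degree r \<le> d \<and> (\<forall>j\<in>{1..n}. \<bar>poly r (real j)\<bar> \<le> R) \<and>
      nondegenerate_weights C n d (\<lambda>j. exp (poly r (real j) - s * p j))"
      unfolding w_def nondegenerate_weights_def by (intro exI[of _ r]) blast
  qed
qed

section \<open>The polynomial system\<close>

definition moment_exponent :: "nat \<Rightarrow> nat \<Rightarrow> nat \<Rightarrow>\<^sub>0 nat" where
  "moment_exponent d j = Abs_poly_mapping (\<lambda>k. if k < d then j ^ Suc k else 0)"

lemma lookup_moment_exponent:
  "Poly_Mapping.lookup (moment_exponent d j) k = (if k < d then j ^ Suc k else 0)"
proof -
  have "finite {k. (if k < d then j ^ Suc k else 0) \<noteq> 0}"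
    by (rule finite_subset[of _ "{..<d}"]) (auto split: if_splits)
  then show ?thesis
    by (simp add: moment_exponent_def)
qed

lemma keys_moment_exponent: "Poly_Mapping.keys (moment_exponent d j) \<subseteq> {..<d}"
  by (auto simp: lookup_moment_exponent in_keys_iff split: if_splits)

lemma inj_moment_exponent: "0 < d \<Longrightarrow> inj (moment_exponent d)"
  by (rule injI, drule arg_cong[where f = "\<lambda>m. Poly_Mapping.lookup m 0"])
    (simp add: lookup_moment_exponent)

text \<open>The monomials are the vertices of the cyclic polytope, and the coefficients are those of \<open>C\<close>
  times \<open>t\<close> to the power of the height, for \<open>t = exp (- s)\<close>.\<close>
definition viro_system :: "real mat \<Rightarrow> nat \<Rightarrow> real \<Rightarrow> nat \<Rightarrow> nat \<Rightarrow> rpoly" where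
  "viro_system C n s d i = (\<Sum>j=1..n. Poly_Mapping.single (moment_exponent d j)
     (C $$ (i, j - 1) * exp (- s * real j ^ Suc d)))"

lemma keys_viro_system: "Poly_Mapping.keys (viro_system C n s d i) \<subseteq> moment_exponent d ` {1..n}"
proof
  fix m assume "m \<in> Poly_Mapping.keys (viro_system C n s d i)"
  then have "(\<Sum>j=1..n. Poly_Mapping.lookup (Poly_Mapping.single (moment_exponent d j)
      (C $$ (i, j - 1) * exp (- s * real j ^ Suc d))) m) \<noteq> 0"
    by (simp add: in_keys_iff viro_system_def lookup_sum)
  then obtain j where "j \<in> {1..n}" "Poly_Mapping.lookup (Poly_Mapping.single (moment_exponent d j)
      (C $$ (i, j - 1) * exp (- s * real j ^ Suc d))) m \<noteq> 0"
    by (rule sum.not_neutral_contains_not_neutral)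
  then show "m \<in> moment_exponent d ` {1..n}"
    by (auto simp: lookup_single when_def split: if_splits)
qed

lemma viro_system_in_fewnomial_systems: "viro_system C (2 * d + 1) s d \<in> fewnomial_systems d d"
proof -
  let ?U = "\<Union>i<d. Poly_Mapping.keys (viro_system C (2 * d + 1) s d i)"
  have sub: "?U \<subseteq> moment_exponent d ` {1..2 * d + 1}"
    using keys_viro_system by blast
  then have "card ?U \<le> card (moment_exponent d ` {1..2 * d + 1})"
    by (intro card_mono) auto
  also have "\<dots> \<le> card {1..2 * d + 1}"
    by (rule card_image_le) simp
  finally have "card ?U \<le> d + d + 1"
    by simp
  moreover have "Poly_Mapping.keys m \<subseteq> {..<d}" if "i < d" "m \<in> Poly_Mapping.keys (viro_system C (2 * d + 1) s d i)" for i m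
    using that sub keys_moment_exponent by blast
  ultimately show ?thesis
    by (auto simp: fewnomial_systems_def)
qed

lemma poly_val_viro_system:
  assumes "0 < d"
  shows "poly_val (viro_system C n s d i) x =
    (\<Sum>j=1..n. C $$ (i, j - 1) * exp (- s * real j ^ Suc d) * (\<Prod>k<d. x k ^ (j ^ Suc k)))"
proof -
  let ?p = "viro_system C n s d i" and ?\<alpha> = "moment_exponent d"
  let ?mon = "\<lambda>m. \<Prod>k\<in>Poly_Mapping.keys m. x k ^ Poly_Mapping.lookup m k"
  have inj: "inj_on ?\<alpha> {1..n}"
    using inj_moment_exponent[OF assms] by (rule inj_on_subset) simp
  have "poly_val ?p x = (\<Sum>m\<in>?\<alpha> ` {1..n}. Poly_Mapping.lookup ?p m * ?mon m)"
    unfolding poly_val_def using keys_viro_system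
    by (intro sum.mono_neutral_left) (auto simp: in_keys_iff)
  also have "\<dots> = (\<Sum>j=1..n. Poly_Mapping.lookup ?p (?\<alpha> j) * ?mon (?\<alpha> j))"
    by (subst sum.reindex[OF inj]) (simp add: o_def)
  also have "\<dots> = (\<Sum>j=1..n. C $$ (i, j - 1) * exp (- s * real j ^ Suc d) * (\<Prod>k<d. x k ^ (j ^ Suc k)))"
  proof (rule sum.cong[OF refl])
    fix j assume j: "j \<in> {1..n}"
    have "Poly_Mapping.lookup ?p (?\<alpha> j) =
        (\<Sum>j'=1..n. if j' = j then C $$ (i, j' - 1) * exp (- s * real j' ^ Suc d) else 0)"
      unfolding viro_system_def lookup_sum using injD[OF inj_moment_exponent[OF assms]]
      by (intro sum.cong) (auto simp: lookup_single when_def)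
    then have "Poly_Mapping.lookup ?p (?\<alpha> j) = C $$ (i, j - 1) * exp (- s * real j ^ Suc d)"
      using j by simp
    moreover have "?mon (?\<alpha> j) = (\<Prod>k<d. x k ^ (j ^ Suc k))"
    proof -
      have "?mon (?\<alpha> j) = (\<Prod>k<d. x k ^ Poly_Mapping.lookup (?\<alpha> j) k)"
        using keys_moment_exponent by (intro prod.mono_neutral_left) (auto simp: in_keys_iff)
      then show ?thesis
        by (simp add: lookup_moment_exponent)
    qed
    ultimately show "Poly_Mapping.lookup ?p (?\<alpha> j) * ?mon (?\<alpha> j) =
        C $$ (i, j - 1) * exp (- s * real j ^ Suc d) * (\<Prod>k<d. x k ^ (j ^ Suc k))"
      by simp
  qed
  finally show ?thesis .
qed

lemma jacobian_viro_system:
  assumes "i < d" "l < d" "x l \<noteq> 0"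
  shows "jacobian d (viro_system C n s d) x $$ (i, l) =
    (\<Sum>j=1..n. C $$ (i, j - 1) * exp (- s * real j ^ Suc d) * (\<Prod>k<d. x k ^ (j ^ Suc k)) * real j ^ Suc l) / x l"
proof -
  have d: "0 < d"
    using assms(1) by simp
  have split: "(\<Prod>k<d. (x(l := t)) k ^ (j ^ Suc k)) = t ^ (j ^ Suc l) * (\<Prod>k\<in>{..<d} - {l}. x k ^ (j ^ Suc k))" for t j
    using assms(2) by (subst prod.remove[of _ l]) auto
  have D: "((\<lambda>t. \<Prod>k<d. (x(l := t)) k ^ (j ^ Suc k)) has_field_derivative
      (\<Prod>k<d. x k ^ (j ^ Suc k)) * real j ^ Suc l / x l) (at (x l))" for j
  proof -
    let ?e = "j ^ Suc l" and ?Q = "\<Prod>k\<in>{..<d} - {l}. x k ^ (j ^ Suc k)"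
    have power: "real e * x l ^ (e - 1) * Q = x l ^ e * Q * real e / x l" for e Q
      using assms(3) by (cases e) auto
    have "((\<lambda>t. t ^ ?e * ?Q) has_field_derivative of_nat ?e * x l ^ (?e - 1) * ?Q) (at (x l))"
      by (auto intro!: derivative_eq_intros)
    also have "of_nat ?e * x l ^ (?e - 1) * ?Q = x l ^ ?e * ?Q * real j ^ Suc l / x l"
      using power[of ?e ?Q] by simp
    also have "x l ^ ?e * ?Q = (\<Prod>k<d. x k ^ (j ^ Suc k))"
      using split[of "x l" j] by simp
    finally show ?thesis
      unfolding split .
  qed
  have "((\<lambda>t. poly_val (viro_system C n s d i) (x(l := t))) has_field_derivative
      (\<Sum>j=1..n. C $$ (i, j - 1) * exp (- s * real j ^ Suc d) * ((\<Prod>k<d. x k ^ (j ^ Suc k)) * real j ^ Suc l / x l)))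
      (at (x l))"
    unfolding poly_val_viro_system[OF d] by (intro DERIV_sum DERIV_cmult D)
  then show ?thesis
    using assms(1,2) by (simp add: jacobian_def DERIV_imp_deriv sum_divide_distrib mult.assoc)
qed

text \<open>A polynomial of degree at most \<open>d\<close> represents a positive point by its non-constant coefficients:
  the value at \<open>j\<close> is then the logarithm of the \<open>j\<close>-th monomial, up to the constant coefficient.\<close>
definition exp_point :: "nat \<Rightarrow> real poly \<Rightarrow> nat \<Rightarrow> real" where
  "exp_point d q = (\<lambda>k\<in>{..<d}. exp (coeff q (Suc k)))"

lemma prod_exp_point:
  assumes "degree q \<le> d"
  shows "(\<Prod>k<d. exp_point d q k ^ (j ^ Suc k)) = exp (poly q (real j) - coeff q 0)"
proof -
  have "(\<Prod>k<d. exp_point d q k ^ (j ^ Suc k)) = exp (\<Sum>k<d. coeff q (Suc k) * real j ^ Suc k)"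
    by (simp add: exp_point_def exp_sum exp_of_nat_mult[symmetric] mult.commute)
  also have "(\<Sum>k<d. coeff q (Suc k) * real j ^ Suc k) = (\<Sum>k\<le>d. coeff q k * real j ^ k) - coeff q 0"
    by (simp add: lessThan_Suc_atMost[symmetric] sum.lessThan_Suc_shift del: sum.lessThan_Suc)
  also have "(\<Sum>k\<le>d. coeff q k * real j ^ k) = poly q (real j)"
    unfolding poly_altdef using assms by (intro sum.mono_neutral_right) (auto simp: coeff_eq_0)
  finally show ?thesis .
qed

text \<open>The Jacobian is the product of \<open>C\<close>, the diagonal matrix of weights, the matrix of exponents and
  the inverse of the diagonal matrix of coordinates. A kernel vector, divided by the coordinates,
  thus gives the coefficients of a polynomial without constant term as in the definition of
  nondegenerate weights; that polynomial is constant, hence zero.\<close>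
lemma exp_point_nondegenerate_solution:
  assumes "0 < d" and deg: "degree q \<le> d"
    and weights: "nondegenerate_weights C n d (\<lambda>j. exp (poly q (real j) - s * real j ^ Suc d))"
  shows "exp_point d q \<in> nondegenerate_positive_solutions d (viro_system C n s d)"
proof -
  let ?x = "exp_point d q" and ?p = "viro_system C n s d"
  define c where "c = exp (- coeff q 0)"
  have c: "c \<noteq> 0"
    by (simp add: c_def)
  define w where "w j = exp (poly q (real j) - s * real j ^ Suc d)" for j
  have x_pos: "0 < ?x k" if "k < d" for k
    using that by (simp add: exp_point_def)
  have x: "?x \<in> {..<d} \<rightarrow>\<^sub>E {0<..}"
    by (auto simp: exp_point_def)
  have weight: "exp (- s * real j ^ Suc d) * (\<Prod>k<d. ?x k ^ (j ^ Suc k)) = c * w j" for j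
    unfolding prod_exp_point[OF deg] c_def w_def exp_add[symmetric] by (simp add: algebra_simps)
  have "poly_val (?p i) ?x = 0" if "i < d" for i
  proof -
    have "poly_val (?p i) ?x = c * (\<Sum>j=1..n. C $$ (i, j - 1) * w j)"
      unfolding poly_val_viro_system[OF assms(1)] mult.assoc weight by (simp add: sum_distrib_left mult_ac)
    then show ?thesis
      using weights that by (simp add: w_def nondegenerate_weights_def)
  qed
  moreover have "invertible_mat (jacobian d ?p ?x)"
  proof -
    let ?J = "jacobian d ?p ?x"
    have J: "?J \<in> carrier_mat d d"
      by (simp add: jacobian_def)
    have J_index: "?J $$ (i, l) = c * (\<Sum>j=1..n. C $$ (i, j - 1) * w j * real j ^ Suc l) / ?x l" if "i < d" "l < d" for i l
    proof -
      have "?x l \<noteq> 0"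
        using x_pos[OF that(2)] by simp
      have "?J $$ (i, l) = (\<Sum>j=1..n. C $$ (i, j - 1) * (exp (- s * real j ^ Suc d) * (\<Prod>k<d. ?x k ^ (j ^ Suc k))) * real j ^ Suc l) / ?x l"
        unfolding jacobian_viro_system[of i d l ?x, OF that \<open>?x l \<noteq> 0\<close>] by (simp only: mult.assoc)
      then show ?thesis
        unfolding weight by (simp add: sum_distrib_left mult_ac)
    qed
    have "det ?J \<noteq> 0"
    proof
      assume "det ?J = 0"
      then obtain v where v: "v \<in> carrier_vec d" "v \<noteq> 0\<^sub>v d" "?J *\<^sub>v v = 0\<^sub>v d"
        using det_0_iff_vec_prod_zero_field[OF J] by auto
      define u where "u = (\<Sum>l<d. monom (v $ l / ?x l) (Suc l))"
      have coeff_u: "coeff u (Suc l) = v $ l / ?x l" if "l < d" for l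
      proof -
        have "coeff u (Suc l) = (\<Sum>l'<d. if l' = l then v $ l' / ?x l' else 0)"
          by (auto simp: u_def coeff_sum intro!: sum.cong)
        then show ?thesis
          using that by simp
      qed
      have "degree u \<le> d"
        unfolding u_def by (rule degree_sum_le) (auto intro: order_trans[OF degree_monom_le])
      moreover have "(\<Sum>j=1..n. C $$ (i, j - 1) * exp (poly q (real j) - s * real j ^ Suc d) * poly u (real j)) = 0"
        if i: "i < d" for i
      proof -
        have "0 = (?J *\<^sub>v v) $ i"
          using i v(3) by simp
        also have "\<dots> = (\<Sum>l<d. ?J $$ (i, l) * v $ l)"
          using i J v(1) by (simp add: scalar_prod_def atLeast0LessThan)
        also have "\<dots> = (\<Sum>l<d. \<Sum>j=1..n. c * (C $$ (i, j - 1) * w j * (real j ^ Suc l * (v $ l / ?x l))))"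
          using i by (intro sum.cong) (auto simp: J_index sum_distrib_left sum_distrib_right sum_divide_distrib mult_ac)
        also have "\<dots> = c * (\<Sum>j=1..n. C $$ (i, j - 1) * w j * (\<Sum>l<d. real j ^ Suc l * (v $ l / ?x l)))"
          by (subst sum.swap) (simp add: sum_distrib_left)
        also have "(\<lambda>j. \<Sum>l<d. real j ^ Suc l * (v $ l / ?x l)) = (\<lambda>j. poly u (real j))"
          by (simp add: u_def poly_sum poly_monom mult_ac)
        finally show ?thesis
          using c by (simp add: w_def)
      qed
      ultimately have "degree u = 0"
        using weights unfolding nondegenerate_weights_def by blast
      then have "v $ l = 0" if "l < d" for l
        using coeff_u[OF that] x_pos[OF that] by (simp add: coeff_eq_0)
      then show False
        using v(1,2) by auto
    qed
    from det_non_zero_imp_unit[OF J this, of "()"]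
    obtain B where "B \<in> carrier_mat d d" "B * ?J = 1\<^sub>m d" "?J * B = 1\<^sub>m d"
      unfolding Units_def ring_mat_def by auto
    then show ?thesis
      using J unfolding invertible_mat_def inverts_mat_def by auto
  qed
  ultimately show ?thesis
    using x by (simp add: nondegenerate_positive_solutions_def)
qed

section \<open>Solutions from different simplices\<close>

lemma admissible_gaps: "admissible n m is \<Longrightarrow> sorted_wrt (\<lambda>i j. i + 2 \<le> j) is"
  by (subst successively_conv_sorted_wrt[symmetric])
    (auto simp: admissible_def transp_def elim!: successively_mono split: if_splits)

lemma admissible_sorted_distinct:
  assumes "admissible n m is"
  shows "sorted is" "distinct is"
proof -
  have "sorted_wrt (<) is"
    by (rule sorted_wrt_mono_rel[OF _ admissible_gaps[OF assms]]) simp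
  then show "sorted is" "distinct is"
    by (simp_all add: strict_sorted_iff)
qed

lemma admissible_no_successor:
  assumes "admissible n m is" "i \<in> set is"
  shows "Suc i \<notin> set is"
proof
  assume "Suc i \<in> set is"
  then obtain a b where ab: "a < length is" "is ! a = i" "b < length is" "is ! b = Suc i"
    using assms(2) by (metis in_set_conv_nth)
  have *: "is ! k + 2 \<le> is ! l" if "k < l" "l < length is" for k l
    using admissible_gaps[OF assms(1)] that by (auto simp: sorted_wrt_iff_nth_less)
  show False
    using *[of a b] *[of b a] ab by (cases a b rule: linorder_cases) auto
qed

lemma card_pair_simplex:
  assumes "admissible n m is"
  shows "card (pair_simplex is) = 2 * m"
proof -
  have "set is \<inter> Suc ` set is = {}"
    using admissible_no_successor[OF assms] by auto
  then have "card (pair_simplex is) = card (set is) + card (Suc ` set is)"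
    unfolding pair_simplex_def by (intro card_Un_disjoint) auto
  also have "card (Suc ` set is) = card (set is)"
    by (rule card_image) simp
  also have "card (set is) = m"
    using admissible_sorted_distinct(2)[OF assms] assms by (simp add: distinct_card admissible_def)
  finally show ?thesis
    by simp
qed

lemma pair_simplex_subset: "admissible n m is \<Longrightarrow> pair_simplex is \<subseteq> {1..n}"
  by (fastforce simp: pair_simplex_def admissible_def)

text \<open>The entries are recovered from left to right: a vertex is an entry unless its predecessor is one.\<close>
lemma pair_simplex_inj:
  assumes "admissible n m is" "admissible n m js" "pair_simplex is = pair_simplex js"
  shows "is = js"
proof -
  have mem: "i \<in> set ks \<longleftrightarrow> i \<in> pair_simplex ks \<and> \<not> (\<exists>i'. i = Suc i' \<and> i' \<in> set ks)"
    if "admissible n m ks" for ks i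
    using admissible_no_successor[OF that] by (auto simp: pair_simplex_def)
  have "i \<in> set is \<longleftrightarrow> i \<in> set js" for i
  proof (induction i)
    case 0
    then show ?case
      using mem[OF assms(1), of 0] mem[OF assms(2), of 0] assms(3) by simp
  next
    case (Suc i)
    then show ?case
      using mem[OF assms(1), of "Suc i"] mem[OF assms(2), of "Suc i"] assms(3) by simp
  qed
  then show ?thesis
    using admissible_sorted_distinct assms(1,2) by (intro sorted_distinct_set_unique) auto
qed

text \<open>A simplex consists of pairs of consecutive integers, so an integer outside the simplex has an even
  number of vertices on each side: the vertices are the zeros of a polynomial that is positive at
  all other integers. This is Gale's evenness condition for the lower facets.\<close>
lemma node_poly_pair_simplex:
  assumes "admissible n m is"
  shows "poly (node_poly (pair_simplex is)) (real j) = (\<Prod>i\<in>set is. real_of_int ((int j - int i) * (int j - int i - 1)))"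
proof -
  have "set is \<inter> Suc ` set is = {}"
    using admissible_no_successor[OF assms] by auto
  then have "(\<Prod>v\<in>pair_simplex is. real j - real v) = (\<Prod>v\<in>set is. real j - real v) * (\<Prod>v\<in>Suc ` set is. real j - real v)"
    unfolding pair_simplex_def by (intro prod.union_disjoint) auto
  also have "(\<Prod>v\<in>Suc ` set is. real j - real v) = (\<Prod>v\<in>set is. real j - real (Suc v))"
    by (subst prod.reindex) (auto simp: o_def)
  finally show ?thesis
    by (simp add: poly_node_poly prod.distrib[symmetric] algebra_simps)
qed

lemma node_poly_pair_simplex_ge_1:
  assumes "admissible n m is" "j \<notin> pair_simplex is"
  shows "1 \<le> poly (node_poly (pair_simplex is)) (real j)"
  unfolding node_poly_pair_simplex[OF assms(1)]
proof (rule prod_ge_1)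
  fix i assume "i \<in> set is"
  then have ne: "j \<noteq> i" "j \<noteq> Suc i"
    using assms(2) by (auto simp: pair_simplex_def)
  have "0 < (int j - int i) * (int j - int i - 1)"
    using ne by (cases "j < i") (auto intro!: mult_pos_pos mult_neg_neg)
  then show "1 \<le> real_of_int ((int j - int i) * (int j - int i - 1))"
    by linarith
qed

lemma exp_point_eq_imp_const_diff:
  assumes "degree q \<le> d" "degree q' \<le> d" "exp_point d q = exp_point d q'"
  shows "poly q x - poly q' x = coeff q 0 - coeff q' 0"
proof -
  have "coeff q (Suc k) = coeff q' (Suc k)" for k
  proof (cases "k < d")
    case True
    then show ?thesis
      using fun_cong[OF assms(3), of k] by (simp add: exp_point_def)
  next
    case False
    then show ?thesis
      using assms(1,2) by (simp add: coeff_eq_0)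
  qed
  then have "q - q' = [:coeff q 0 - coeff q' 0:]"
    by (intro poly_eqI) (auto simp: coeff_pCons split: nat.splits)
  from arg_cong[OF this, of "\<lambda>u. poly u x"] show ?thesis
    by simp
qed

text \<open>For large \<open>s\<close> every maximal simplex contributes a solution of one and the same system. The
  polynomial \<open>q is\<close> representing it is \<open>s\<close> times the affine function that supports the lifted
  simplex, plus the bounded correction \<open>r is\<close>. Different simplices give different points: two
  polynomials representing the same point differ by a constant, but their difference is large
  and positive at a vertex of the first simplex outside the second one, and large and negative
  at a vertex of the second one outside the first.\<close>
lemma card_admissible_le_Xi:
  assumes "odd d" and dec: "positively_decorable (2 * d + 1) d (S_complex (2 * d + 1) d)"
  shows "enat (card {is. admissible (2 * d + 1) ((d + 1) div 2) is}) \<le> Xi d d"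
proof -
  define n where "n = 2 * d + 1"
  define V where "V = {is. admissible n ((d + 1) div 2) is}"
  have "0 < d"
    using \<open>odd d\<close> by (rule odd_pos)
  have fin: "finite V"
    unfolding V_def by (rule finite_admissible)
  obtain C where C: "C \<in> carrier_mat d n"
    and or: "\<And>\<sigma>. \<sigma> \<in> S_complex n d \<Longrightarrow> card \<sigma> = d + 1 \<Longrightarrow> oriented d (submatrix C UNIV ((\<lambda>v. v - 1) ` \<sigma>))"
    using dec unfolding positively_decorable_def n_def by blast
  define p where "p is j = poly (node_poly (pair_simplex is)) (real j)" for "is" j
  have V: "pair_simplex is \<subseteq> {1..n}" "card (pair_simplex is) = d + 1" "pair_simplex is \<in> S_complex n d"
    if "is \<in> V" for "is"
  proof -
    have adm: "admissible n ((d + 1) div 2) is"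
      using that by (simp add: V_def)
    then show "pair_simplex is \<subseteq> {1..n}" "card (pair_simplex is) = d + 1"
      using pair_simplex_subset card_pair_simplex[OF adm] \<open>odd d\<close> by auto
    show "pair_simplex is \<in> S_complex n d"
      using adm unfolding admissible_iff_paired_indices[OF \<open>odd d\<close>] S_complex_def by blast
  qed
  have p0: "p is j = 0" if "is \<in> V" "j \<in> pair_simplex is" for "is" j
    using that finite_subset[OF V(1)] by (auto simp: p_def poly_node_poly intro!: prod_zero)
  have p1: "1 \<le> p is j" if "is \<in> V" "j \<notin> pair_simplex is" for "is" j
    unfolding p_def using that by (intro node_poly_pair_simplex_ge_1) (auto simp: V_def)
  define branch where "branch is R s r \<longleftrightarrow> degree r \<le> d \<and> (\<forall>j\<in>{1..n}. \<bar>poly r (real j)\<bar> \<le> R) \<and>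
      nondegenerate_weights C n d (\<lambda>j. exp (poly r (real j) - s * p is j))" for "is" R s r
  have "\<exists>s0 R. \<forall>s\<ge>s0. \<exists>r. branch is R s r" if "is \<in> V" for "is"
    by (rule oriented_simplex_persists[OF C V(1,2)[OF that] or[OF V(3,2)[OF that]], of "p is"])
      (use p0[OF that] p1[OF that] in \<open>auto simp: branch_def\<close>)
  then obtain s0 R where branches: "\<And>is s. is \<in> V \<Longrightarrow> s0 is \<le> s \<Longrightarrow> \<exists>r. branch is (R is) s r"
    by metis
  \<comment> \<open>One value of \<open>s\<close> beyond all thresholds and all bounds; the factor 2 makes \<open>s\<close> exceed the sum of any two bounds.\<close>
  define s where "s = 1 + (\<Sum>is\<in>V. \<bar>s0 is\<bar>) + 2 * (\<Sum>is\<in>V. \<bar>R is\<bar>)"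
  have s: "s0 is \<le> s" "2 * R is < s" if "is \<in> V" for "is"
    using member_le_sum[of "is" V "\<lambda>is. \<bar>s0 is\<bar>"] member_le_sum[of "is" V "\<lambda>is. \<bar>R is\<bar>"] fin that
      sum_nonneg[of V "\<lambda>is. \<bar>s0 is\<bar>"] sum_nonneg[of V "\<lambda>is. \<bar>R is\<bar>"]
    by (auto simp: s_def)
  obtain r where r: "\<And>is. is \<in> V \<Longrightarrow> branch is (R is) s (r is)"
    using branches[OF _ s(1)] by metis
  define q where "q is = smult s (monom 1 (Suc d) - node_poly (pair_simplex is)) + r is" for "is"
  have q_deg: "degree (q is) \<le> d" if "is \<in> V" for "is"
    unfolding q_def using degree_monom_minus_node_poly[of "pair_simplex is" d] V(2)[OF that] r[OF that]
    by (intro degree_add_le order_trans[OF degree_smult_le]) (auto simp: branch_def)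
  have q_val: "poly (q is) (real j) - s * real j ^ Suc d = poly (r is) (real j) - s * p is j" for "is" j
    by (simp add: q_def p_def poly_monom algebra_simps)
  have inj: "inj_on (\<lambda>is. exp_point d (q is)) V"
  proof (rule inj_onI, rule ccontr)
    fix "is" js assume V2: "is \<in> V" "js \<in> V" and eq: "exp_point d (q is) = exp_point d (q js)" and "is \<noteq> js"
    have ne: "pair_simplex is \<noteq> pair_simplex js"
      using V2 \<open>is \<noteq> js\<close> pair_simplex_inj unfolding V_def by blast
    have *: "s - (R is + R js) \<le> poly (q is) (real j) - poly (q js) (real j)"
      if "is \<in> V" "js \<in> V" "j \<in> pair_simplex is - pair_simplex js" for "is" js j
    proof -
      have "j \<in> {1..n}"
        using V(1)[OF that(1)] that(3) by blast
      then have "\<bar>poly (r is) (real j)\<bar> \<le> R is" "\<bar>poly (r js) (real j)\<bar> \<le> R js"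
        using r that by (auto simp: branch_def)
      moreover have "s * 1 \<le> s * p js j"
        using p1[OF that(2), of j] that(3) by (intro mult_left_mono) (auto simp: s_def sum_nonneg)
      moreover have "p is j = 0"
        using p0 that by blast
      ultimately show ?thesis
        using q_val[of "is" j] q_val[of js j] by simp
    qed
    have "card (pair_simplex is) = card (pair_simplex js)"
      using V(2) V2 by simp
    moreover have "finite (pair_simplex is)" "finite (pair_simplex js)"
      by (simp_all add: pair_simplex_def)
    ultimately have "pair_simplex is - pair_simplex js \<noteq> {}" "pair_simplex js - pair_simplex is \<noteq> {}"
      using ne card_subset_eq by (metis Diff_eq_empty_iff)+
    then obtain j j' where j: "j \<in> pair_simplex is - pair_simplex js" "j' \<in> pair_simplex js - pair_simplex is"
      by blast
    have "poly (q is) x - poly (q js) x = coeff (q is) 0 - coeff (q js) 0" for x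
      by (rule exp_point_eq_imp_const_diff[OF q_deg q_deg eq]) (use V2 in auto)
    then show False
      using *[OF V2 j(1)] *[OF V2(2,1) j(2)] s(2)[OF V2(1)] s(2)[OF V2(2)] by (smt (verit))
  qed
  let ?sys = "viro_system C n s d"
  let ?sols = "nondegenerate_positive_solutions d ?sys"
  have sub: "(\<lambda>is. exp_point d (q is)) ` V \<subseteq> ?sols"
  proof safe
    fix "is" assume "is \<in> V"
    then have "nondegenerate_weights C n d (\<lambda>j. exp (poly (q is) (real j) - s * real j ^ Suc d))"
      unfolding q_val using r unfolding branch_def by blast
    then show "exp_point d (q is) \<in> ?sols"
      by (rule exp_point_nondegenerate_solution[OF \<open>0 < d\<close> q_deg[OF \<open>is \<in> V\<close>]])
  qed
  have "enat (card V) \<le> ecard ?sols"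
    using card_mono[OF _ sub] card_image[OF inj] by (auto simp: ecard_def)
  also have "\<dots> \<le> Xi d d"
    unfolding Xi_def using viro_system_in_fewnomial_systems[of C d s] by (intro SUP_upper) (simp add: n_def)
  finally show ?thesis
    by (simp add: V_def n_def)
qed

theorem corollary5p7:
  fixes d :: nat
  assumes "odd d"
    and "positively_decorable (2 * d + 1) d (S_complex (2 * d + 1) d)"
  shows "ereal (coeff_XY (2 * d + 1) ((d + 1) div 2)
           ((1 + bX + bX ^ 3 * bY) / (1 - bX ^ 2 - bX ^ 2 * bY - bX ^ 4 * bY)))
         \<le> ereal_of_enat (Xi d d)"
proof -
  have "ereal (coeff_XY (2 * d + 1) ((d + 1) div 2)
      ((1 + bX + bX ^ 3 * bY) / (1 - bX ^ 2 - bX ^ 2 * bY - bX ^ 4 * bY)))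
    \<le> ereal_of_enat (enat (card {is. admissible (2 * d + 1) ((d + 1) div 2) is}))"
    using coeff_XY_le_card_admissible by simp
  also have "\<dots> \<le> ereal_of_enat (Xi d d)"
    using card_admissible_le_Xi[OF assms] by (simp only: ereal_of_enat_le_iff)
  finally show ?thesis .
qed

end
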